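(* Let $T$ be a consistent, recursively enumerable $\mathcal{L}$-theory extending $\mathsf{R}$ and let $\alpha$ be a computable simulation of $A^\ast$. Then there exists no $\mathcal{L}$-formula $\tau(x)$ with $x$ as its only free variable such that $T\vdash\phi\leftrightarrow\tau(\ulcorner\phi\urcorner^{\alpha})$ for every $\mathcal{L}$-sentence $\phi$.
   Context: Language: $\mathcal{L}$ is the first-order arithmetical language with symbols $\mathsf{0},\mathsf{S},+,\times,=,\neg,\wedge,\forall$. The finite alphabet $A$ consists of these symbols together with $\mathsf{v}$, $\prime$, $($ and $)$. $A^\ast$ is the set of nonempty finite strings over $A$, with concatenation $\ast$. Variables are $\mathsf{v}$ followed by finitely many strokes; terms and formulae are the usual well-formed (fully parenthesised, infix) strings in $A^\ast$. Other logical symbols are the usual abbreviations; $x\le y$ abbreviates $\exists z\, z+x=y$. $\overline{n}$ is the standard numeral of $n$. A numbering of $A^\ast$ is an injective function $\alpha\colon A^\ast\to\mathbb{N}$; $\ulcorner\phi\urcorner^{\alpha}$ is the numeral $\overline{\alpha(\phi)}$. Let $G=\alpha(A^\ast)$ and let $\circledast_\alpha\colon G\times G\to G$ be $\circledast_\alpha(m,n)=\alpha(\alpha^{-1}(m)\ast\alpha^{-1}(n))$. $\alpha$ is a computable simulation of $A^\ast$ if $G$ is decidable and $\circledast_\alpha$ is recursive (i.e. a partial recursive function with decidable domain $G\times G$). The theory $\mathsf{R}$ has the axiom schemata (for all $m,n\in\mathbb{N}$): $\overline{m}+\overline{n}=\overline{m+n}$; $\overline{m}\times\overline{n}=\overline{m\cdot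 n}$; $\overline{m}\neq\overline{n}$ for $m\ne n$; $x\le\overline{n}\to\bigvee_{k\le n}x=\overline{k}$; $x\le\overline{n}\vee\overline{n}\le x$. *)

theory Defs
  imports "HOL-Library.Nat_Bijection"
begin

section \<open>Strings over the finite alphabet\<close>

datatype letter =
  LZero | LSuc | LPlus | LTimes | LEq | LNot | LAnd | LAll | LVar | LPrime | LOpen | LClose

definition strings :: "letter list set" where
  "strings = {w. w \<noteq> []}"

section \<open>Terms and formulae\<close>

text \<open>
  Terms and formulae are syntax trees over named variables; the well-formed strings are their
  images under \<open>trm_string\<close> and \<open>fm_string\<close>, which are injective (unique readability, proved
  below). The variable \<open>Var n\<close> is the letter v followed by n strokes.
\<close>

datatype trm = Var nat | Zero | Succ trm | Add trm trm | Mult trm trm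

datatype fm = Eq trm trm | Neg fm | And fm fm | Forall nat fm

definition var_string :: "nat \<Rightarrow> letter list" where
  "var_string n = LVar # replicate n LPrime"

primrec trm_string :: "trm \<Rightarrow> letter list" where
  "trm_string (Var n) = var_string n"
| "trm_string Zero = [LZero]"
| "trm_string (Succ t) = LSuc # trm_string t"
| "trm_string (Add s t) = [LOpen] @ trm_string s @ [LPlus] @ trm_string t @ [LClose]"
| "trm_string (Mult s t) = [LOpen] @ trm_string s @ [LTimes] @ trm_string t @ [LClose]"

primrec fm_string :: "fm \<Rightarrow> letter list" where
  "fm_string (Eq s t) = [LOpen] @ trm_string s @ [LEq] @ trm_string t @ [LClose]"
| "fm_string (Neg p) = LNot # fm_string p"
| "fm_string (And p q) = [LOpen] @ fm_string p @ [LAnd] @ fm_string q @ [LClose]"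
| "fm_string (Forall n p) = LAll # var_string n @ fm_string p"

definition Imp :: "fm \<Rightarrow> fm \<Rightarrow> fm" where
  "Imp p q = Neg (And p (Neg q))"

definition Or :: "fm \<Rightarrow> fm \<Rightarrow> fm" where
  "Or p q = Neg (And (Neg p) (Neg q))"

definition Iff :: "fm \<Rightarrow> fm \<Rightarrow> fm" where
  "Iff p q = And (Imp p q) (Imp q p)"

definition Exists :: "nat \<Rightarrow> fm \<Rightarrow> fm" where
  "Exists n p = Neg (Forall n (Neg p))"

primrec fv_trm :: "trm \<Rightarrow> nat set" where
  "fv_trm (Var n) = {n}"
| "fv_trm Zero = {}"
| "fv_trm (Succ t) = fv_trm t"
| "fv_trm (Add s t) = fv_trm s \<union> fv_trm t"
| "fv_trm (Mult s t) = fv_trm s \<union> fv_trm t"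

primrec fv :: "fm \<Rightarrow> nat set" where
  "fv (Eq s t) = fv_trm s \<union> fv_trm t"
| "fv (Neg p) = fv p"
| "fv (And p q) = fv p \<union> fv q"
| "fv (Forall n p) = fv p - {n}"

definition sentence :: "fm \<Rightarrow> bool" where
  "sentence p \<longleftrightarrow> fv p = {}"

primrec subst_trm :: "nat \<Rightarrow> trm \<Rightarrow> trm \<Rightarrow> trm" where
  "subst_trm x u (Var n) = (if n = x then u else Var n)"
| "subst_trm x u Zero = Zero"
| "subst_trm x u (Succ t) = Succ (subst_trm x u t)"
| "subst_trm x u (Add s t) = Add (subst_trm x u s) (subst_trm x u t)"
| "subst_trm x u (Mult s t) = Mult (subst_trm x u s) (subst_trm x u t)"

text \<open>
  \<open>subst x u p\<close> replaces the free occurrences of the variable \<open>x\<close> in \<open>p\<close> by \<open>u\<close> without renaming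
  bound variables; \<open>free_for u x p\<close> says that this captures no variable of \<open>u\<close>.
\<close>

primrec subst :: "nat \<Rightarrow> trm \<Rightarrow> fm \<Rightarrow> fm" where
  "subst x u (Eq s t) = Eq (subst_trm x u s) (subst_trm x u t)"
| "subst x u (Neg p) = Neg (subst x u p)"
| "subst x u (And p q) = And (subst x u p) (subst x u q)"
| "subst x u (Forall n p) = Forall n (if n = x then p else subst x u p)"

primrec free_for :: "trm \<Rightarrow> nat \<Rightarrow> fm \<Rightarrow> bool" where
  "free_for u x (Eq s t) \<longleftrightarrow> True"
| "free_for u x (Neg p) \<longleftrightarrow> free_for u x p"
| "free_for u x (And p q) \<longleftrightarrow> free_for u x p \<and> free_for u x q"
| "free_for u x (Forall n p) \<longleftrightarrow> x \<notin> fv (Forall n p) \<or> (n \<notin> fv_trm u \<and> free_for u x p)"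

primrec numeral_trm :: "nat \<Rightarrow> trm" where
  "numeral_trm 0 = Zero"
| "numeral_trm (Suc n) = Succ (numeral_trm n)"

section \<open>Derivability in first-order logic with equality\<close>

text \<open>Equations and universally quantified formulae are the propositional atoms.\<close>

primrec prop_eval :: "(fm \<Rightarrow> bool) \<Rightarrow> fm \<Rightarrow> bool" where
  "prop_eval v (Eq s t) \<longleftrightarrow> v (Eq s t)"
| "prop_eval v (Neg p) \<longleftrightarrow> \<not> prop_eval v p"
| "prop_eval v (And p q) \<longleftrightarrow> prop_eval v p \<and> prop_eval v q"
| "prop_eval v (Forall n p) \<longleftrightarrow> v (Forall n p)"

definition tautology :: "fm \<Rightarrow> bool" where
  "tautology p \<longleftrightarrow> (\<forall>v. prop_eval v p)"

text \<open>
  A Hilbert calculus. Generalisation is unrestricted, so an axiom of \<open>T\<close> with free variables has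
  the force of its universal closure.
\<close>

inductive derives :: "fm set \<Rightarrow> fm \<Rightarrow> bool" (infix "\<turnstile>" 50) for T where
  Axiom: "p \<in> T \<Longrightarrow> T \<turnstile> p"
| Taut: "tautology p \<Longrightarrow> T \<turnstile> p"
| Inst: "free_for t x p \<Longrightarrow> T \<turnstile> Imp (Forall x p) (subst x t p)"
| Distrib: "x \<notin> fv p \<Longrightarrow> T \<turnstile> Imp (Forall x (Imp p q)) (Imp p (Forall x q))"
| Refl: "T \<turnstile> Eq t t"
| Leibniz: "free_for s x p \<Longrightarrow> free_for t x p \<Longrightarrow>
    T \<turnstile> Imp (Eq s t) (Imp (subst x s p) (subst x t p))"
| MP: "T \<turnstile> Imp p q \<Longrightarrow> T \<turnstile> p \<Longrightarrow> T \<turnstile> q"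
| Gen: "T \<turnstile> p \<Longrightarrow> T \<turnstile> Forall x p"

definition consistent :: "fm set \<Rightarrow> bool" where
  "consistent T \<longleftrightarrow> \<not> (\<exists>p. T \<turnstile> p \<and> T \<turnstile> Neg p)"

definition extends :: "fm set \<Rightarrow> fm set \<Rightarrow> bool" where
  "extends T U \<longleftrightarrow> (\<forall>p\<in>U. T \<turnstile> p)"

section \<open>The theory R\<close>

definition Le :: "trm \<Rightarrow> trm \<Rightarrow> fm" where
  "Le s t = (let z = (LEAST z. z \<notin> fv_trm s \<union> fv_trm t) in Exists z (Eq (Add (Var z) s) t))"

primrec eq_some_upto :: "trm \<Rightarrow> nat \<Rightarrow> fm" where
  "eq_some_upto t 0 = Eq t (numeral_trm 0)"
| "eq_some_upto t (Suc n) = Or (eq_some_upto t n) (Eq t (numeral_trm (Suc n)))"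

definition theory_R :: "fm set" where
  "theory_R =
     {Eq (Add (numeral_trm m) (numeral_trm n)) (numeral_trm (m + n)) | m n. True} \<union>
     {Eq (Mult (numeral_trm m) (numeral_trm n)) (numeral_trm (m * n)) | m n. True} \<union>
     {Neg (Eq (numeral_trm m) (numeral_trm n)) | m n. m \<noteq> n} \<union>
     {Imp (Le (Var 0) (numeral_trm n)) (eq_some_upto (Var 0) n) | n. True} \<union>
     {Or (Le (Var 0) (numeral_trm n)) (Le (numeral_trm n) (Var 0)) | n. True}"

section \<open>Partial recursive functions\<close>

datatype recf = RZero | RSucc | RProj nat | RComp recf "recf list" | RPrim recf recf | RMu recf

text \<open>
  \<open>rec_eval r xs y\<close>: the computation described by \<open>r\<close> halts on the arguments \<open>xs\<close> with value \<open>y\<close>.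
  Minimisation requires the values at all smaller arguments to be defined and nonzero.
\<close>

inductive rec_eval :: "recf \<Rightarrow> nat list \<Rightarrow> nat \<Rightarrow> bool" where
  "rec_eval RZero xs 0"
| "rec_eval RSucc [x] (Suc x)"
| "i < length xs \<Longrightarrow> rec_eval (RProj i) xs (xs ! i)"
| "list_all2 (\<lambda>g y. rec_eval g xs y) gs ys \<Longrightarrow> rec_eval f ys z \<Longrightarrow> rec_eval (RComp f gs) xs z"
| "rec_eval f xs y \<Longrightarrow> rec_eval (RPrim f g) (0 # xs) y"
| "rec_eval (RPrim f g) (n # xs) y \<Longrightarrow> rec_eval g (n # y # xs) z \<Longrightarrow>
    rec_eval (RPrim f g) (Suc n # xs) z"
| "rec_eval f (n # xs) 0 \<Longrightarrow> (\<forall>m<n. \<exists>y. rec_eval f (m # xs) (Suc y)) \<Longrightarrow>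
    rec_eval (RMu f) xs n"

definition partial_recursive :: "nat \<Rightarrow> (nat list \<Rightarrow> nat option) \<Rightarrow> bool" where
  "partial_recursive k f \<longleftrightarrow>
     (\<exists>r. \<forall>xs. length xs = k \<longrightarrow> (\<forall>y. rec_eval r xs y \<longleftrightarrow> f xs = Some y))"

definition decidable :: "nat \<Rightarrow> nat list set \<Rightarrow> bool" where
  "decidable k D \<longleftrightarrow> partial_recursive k (\<lambda>xs. Some (if xs \<in> D then 1 else 0))"

definition rec_enumerable :: "nat set \<Rightarrow> bool" where
  "rec_enumerable D \<longleftrightarrow> (\<exists>f. partial_recursive 1 f \<and> D = {n. f [n] \<noteq> None})"

text \<open>A fixed effective coding of strings, used to say that a set of formulae is r.e.\<close>

primrec letter_code :: "letter \<Rightarrow> nat" where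
  "letter_code LZero = 0"
| "letter_code LSuc = 1"
| "letter_code LPlus = 2"
| "letter_code LTimes = 3"
| "letter_code LEq = 4"
| "letter_code LNot = 5"
| "letter_code LAnd = 6"
| "letter_code LAll = 7"
| "letter_code LVar = 8"
| "letter_code LPrime = 9"
| "letter_code LOpen = 10"
| "letter_code LClose = 11"

definition string_code :: "letter list \<Rightarrow> nat" where
  "string_code w = list_encode (map letter_code w)"

definition re_theory :: "fm set \<Rightarrow> bool" where
  "re_theory T \<longleftrightarrow> rec_enumerable (string_code ` fm_string ` T)"

section \<open>Numberings of strings\<close>

text \<open>A numbering is a function on nonempty strings; its value on the empty list is irrelevant.\<close>

definition numbering :: "(letter list \<Rightarrow> nat) \<Rightarrow> bool" where
  "numbering \<alpha> \<longleftrightarrow> inj_on \<alpha> strings"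

definition concat_op :: "(letter list \<Rightarrow> nat) \<Rightarrow> nat \<Rightarrow> nat \<Rightarrow> nat" where
  "concat_op \<alpha> m n = \<alpha> (inv_into strings \<alpha> m @ inv_into strings \<alpha> n)"

definition computable_simulation :: "(letter list \<Rightarrow> nat) \<Rightarrow> bool" where
  "computable_simulation \<alpha> \<longleftrightarrow>
     numbering \<alpha> \<and>
     decidable 1 {[n] | n. n \<in> \<alpha> ` strings} \<and>
     decidable 2 {[m, n] | m n. m \<in> \<alpha> ` strings \<and> n \<in> \<alpha> ` strings} \<and>
     partial_recursive 2
       (\<lambda>xs. if xs ! 0 \<in> \<alpha> ` strings \<and> xs ! 1 \<in> \<alpha> ` strings
             then Some (concat_op \<alpha> (xs ! 0) (xs ! 1)) else None)"

definition quote :: "(letter list \<Rightarrow> nat) \<Rightarrow> fm \<Rightarrow> trm" where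
  "quote \<alpha> p = numeral_trm (\<alpha> (fm_string p))"

section \<open>Determinism of evaluation and unique readability\<close>

lemma rec_eval_deterministic:
  "rec_eval r xs y \<Longrightarrow> rec_eval r xs z \<Longrightarrow> y = z"
proof (induction arbitrary: z rule: rec_eval.induct)
  case (1 xs)
  then show ?case by cases auto
next
  case (2 x)
  then show ?case by cases auto
next
  case (3 i xs)
  from "3.prems" show ?case by cases auto
next
  case (4 xs gs ys f z')
  from "4.prems" obtain ys' where a: "list_all2 (\<lambda>g y. rec_eval g xs y) gs ys'"
    and b: "rec_eval f ys' z" by (auto elim: rec_eval.cases)
  have "ys = ys'"
    using 4(1) a by (auto simp: list_all2_conv_all_nth intro!: nth_equalityI)
  with b "4.IH" show ?case by blast
next
  case (5 f xs y g)
  from "5.prems" have "rec_eval f xs z" by cases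
  with "5.IH" show ?case by blast
next
  case (6 f g n xs y z')
  from "6.prems" obtain y' where "rec_eval (RPrim f g) (n # xs) y'" "rec_eval g (n # y' # xs) z"
    by (auto elim: rec_eval.cases)
  with "6.IH" show ?case by blast
next
  case (7 f n xs)
  from "7.prems" have a: "rec_eval f (z # xs) 0"
    and b: "\<forall>m<z. \<exists>y. rec_eval f (m # xs) (Suc y)" by (auto elim: rec_eval.cases)
  show ?case
  proof (rule linorder_cases[of n z])
    assume "n < z"
    with b 7(2) show ?thesis by fastforce
  next
    assume "z < n"
    with a 7(3) show ?thesis by fastforce
  qed
qed

lemma replicate_append_inj:
  assumes "replicate m a @ r = replicate n a @ r'" "take 1 r \<noteq> [a]" "take 1 r' \<noteq> [a]"
  shows "m = n \<and> r = r'"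
  using assms
proof (induction m arbitrary: n)
  case 0 then show ?case by (cases n) auto
next
  case (Suc m) then show ?case by (cases n) auto
qed

lemma trm_string_append_inj:
  "trm_string s @ r = trm_string t @ r' \<Longrightarrow> take 1 r \<noteq> [LPrime] \<Longrightarrow> take 1 r' \<noteq> [LPrime] \<Longrightarrow>
   s = t \<and> r = r'"
proof (induction s arbitrary: t r r')
  case (Var n) then show ?case by (cases t) (auto simp: var_string_def dest: replicate_append_inj)
next
  case Zero then show ?case by (cases t) (auto simp: var_string_def)
next
  case (Succ s)
  show ?case
  proof (cases t)
    case (Succ t')
    with Succ.IH[of r t' r'] Succ.prems show ?thesis by simp
  qed (use Succ.prems in \<open>simp_all add: var_string_def\<close>)
next
  case (Add s1 s2)
  show ?case
  proof (cases t)
    case (Add t1 t2)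
    with Add.IH(1)[of "LPlus # trm_string s2 @ LClose # r" t1 "LPlus # trm_string t2 @ LClose # r'"]
      Add.IH(2)[of "LClose # r" t2 "LClose # r'"] Add.prems show ?thesis by simp
  next
    case (Mult t1 t2)
    with Add.IH(1)[of "LPlus # trm_string s2 @ LClose # r" t1 "LTimes # trm_string t2 @ LClose # r'"]
      Add.prems show ?thesis by simp
  qed (use Add.prems in \<open>simp_all add: var_string_def\<close>)
next
  case (Mult s1 s2)
  show ?case
  proof (cases t)
    case (Mult t1 t2)
    with Mult.IH(1)[of "LTimes # trm_string s2 @ LClose # r" t1 "LTimes # trm_string t2 @ LClose # r'"]
      Mult.IH(2)[of "LClose # r" t2 "LClose # r'"] Mult.prems show ?thesis by simp
  next
    case (Add t1 t2)
    with Mult.IH(1)[of "LTimes # trm_string s2 @ LClose # r" t1 "LPlus # trm_string t2 @ LClose # r'"]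
      Mult.prems show ?thesis by simp
  qed (use Mult.prems in \<open>simp_all add: var_string_def\<close>)
qed

lemma trm_string_neq_fm_string:
  "take 1 r \<noteq> [LPrime] \<Longrightarrow> trm_string s @ r \<noteq> fm_string p @ r'"
proof (induction p arbitrary: s r r')
  case (Eq t1 t2)
  show ?case
  proof (cases s)
    case (Add s1 s2)
    with trm_string_append_inj[of s1 "LPlus # trm_string s2 @ LClose # r" t1
        "LEq # trm_string t2 @ LClose # r'"] show ?thesis by auto
  next
    case (Mult s1 s2)
    with trm_string_append_inj[of s1 "LTimes # trm_string s2 @ LClose # r" t1
        "LEq # trm_string t2 @ LClose # r'"] show ?thesis by auto
  qed (simp_all add: var_string_def)
next
  case (And p q)
  show ?case
  proof (cases s)
    case (Add s1 s2)
    with And.IH(1)[of "LPlus # trm_string s2 @ LClose # r" s1 "LAnd # fm_string q @ LClose # r'"]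
    show ?thesis by simp
  next
    case (Mult s1 s2)
    with And.IH(1)[of "LTimes # trm_string s2 @ LClose # r" s1 "LAnd # fm_string q @ LClose # r'"]
    show ?thesis by simp
  qed (simp_all add: var_string_def)
next
  case (Neg p) show ?case by (cases s) (simp_all add: var_string_def)
next
  case (Forall n p) show ?case by (cases s) (simp_all add: var_string_def)
qed

lemma take_fm_string: "take 1 (fm_string p @ r) \<noteq> [LPrime]"
  by (cases p) auto

lemma fm_string_append_inj: "fm_string p @ r = fm_string q @ r' \<Longrightarrow> p = q \<and> r = r'"
proof (induction p arbitrary: q r r')
  case (Eq s1 s2)
  show ?case
  proof (cases q)
    case (Eq t1 t2)
    with Eq.prems trm_string_append_inj[of s1 "LEq # trm_string s2 @ LClose # r" t1
        "LEq # trm_string t2 @ LClose # r'"]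
      trm_string_append_inj[of s2 "LClose # r" t2 "LClose # r'"]
    show ?thesis by simp
  next
    case (And q1 q2)
    with Eq.prems trm_string_neq_fm_string[of "LEq # trm_string s2 @ LClose # r" s1 q1
        "LAnd # fm_string q2 @ LClose # r'"] show ?thesis by simp
  qed (use Eq.prems in simp_all)
next
  case (Neg p)
  show ?case
  proof (cases q)
    case (Neg q')
    with Neg.IH[of r q' r'] Neg.prems show ?thesis by simp
  qed (use Neg.prems in simp_all)
next
  case (And p1 p2)
  show ?case
  proof (cases q)
    case (And q1 q2)
    with And.prems And.IH(1)[of "LAnd # fm_string p2 @ LClose # r" q1
        "LAnd # fm_string q2 @ LClose # r'"] And.IH(2)[of "LClose # r" q2 "LClose # r'"]
    show ?thesis by simp
  next
    case (Eq t1 t2)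
    with And.prems trm_string_neq_fm_string[of "LEq # trm_string t2 @ LClose # r'" t1 p1
        "LAnd # fm_string p2 @ LClose # r"] show ?thesis by simp
  qed (use And.prems in simp_all)
next
  case (Forall n p)
  show ?case
  proof (cases q)
    case (Forall m q')
    with Forall.prems have "replicate n LPrime @ fm_string p @ r = replicate m LPrime @ fm_string q' @ r'"
      by (simp add: var_string_def)
    from replicate_append_inj[OF this take_fm_string take_fm_string]
    have "n = m" and "fm_string p @ r = fm_string q' @ r'" by auto
    with Forall.IH[of r q' r'] Forall show ?thesis by simp
  qed (use Forall.prems in simp_all)
qed

lemma inj_trm_string: "inj trm_string"
  using trm_string_append_inj[of _ "[]" _ "[]"] by (auto intro: injI)

lemma inj_fm_string: "inj fm_string"
  using fm_string_append_inj[of _ "[]" _ "[]"] by (auto intro: injI)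

end

theory Submission
  imports Defs "HOL-Number_Theory.Cong"
begin

text \<open>R has no induction and no recursion equations: it tabulates sums and products of
  numerals and compares an arbitrary element with a numeral. So provable uniqueness of a function
  value cannot come from a general theorem inside \<open>T\<close>; functionality is known for the
  natural numbers only and has to be carried over to nonstandard elements. Bounding is the means:
  whatever lies below a numeral is provably one of finitely many numerals, and the wrong ones can be
  refuted one at a time. The existential formula that defines a graph is not enough as it stands,
  since a spurious value might have a nonstandard witness. The shape of the diagonal sentence is due
  to \<open>\<alpha>\<close>: only concatenation is given as a recursive operation on codes, and a
  substitution function would first have to decode them.\<close>

text \<open>
  This is Tarski's argument. Since concatenation is recursive on codes, so is the map sending the
  code \<open>n\<close> of a string \<open>\<psi>\<close> to the code of \<open>\<forall>v \<not>(v = n \<and> \<psi>)\<close>; this sentence diagonalises \<open>\<psi>\<close> by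
  concatenation alone, without computing a substitution. The graph of every partial recursive
  function is defined by an existential formula over a matrix that R decides at numerals, with
  primitive recursion handled by the beta function. Restricting to the least bound for a witness,
  which R pins down because it compares every element with each numeral, turns this definition
  into a representation, and the fixed point of \<open>\<not>\<tau>\<close> refutes \<open>\<tau>\<close>.
\<close>

section \<open>Derived rules\<close>

lemma prop_eval_connectives [simp]:
  "prop_eval v (Imp p q) \<longleftrightarrow> (prop_eval v p \<longrightarrow> prop_eval v q)"
  "prop_eval v (Or p q) \<longleftrightarrow> prop_eval v p \<or> prop_eval v q"
  "prop_eval v (Iff p q) \<longleftrightarrow> (prop_eval v p \<longleftrightarrow> prop_eval v q)"
  by (auto simp: Imp_def Or_def Iff_def)

lemma subst_connectives [simp]:
  "subst x t (Imp p q) = Imp (subst x t p) (subst x t q)"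
  "subst x t (Or p q) = Or (subst x t p) (subst x t q)"
  "subst x t (Iff p q) = Iff (subst x t p) (subst x t q)"
  "subst x t (Exists n p) = Exists n (if n = x then p else subst x t p)"
  by (auto simp: Imp_def Or_def Iff_def Exists_def)

lemma fv_connectives [simp]:
  "fv (Imp p q) = fv p \<union> fv q"
  "fv (Or p q) = fv p \<union> fv q"
  "fv (Iff p q) = fv p \<union> fv q"
  "fv (Exists n p) = fv p - {n}"
  by (auto simp: Imp_def Or_def Iff_def Exists_def)

lemma free_for_connectives [simp]:
  "free_for t x (Imp p q) \<longleftrightarrow> free_for t x p \<and> free_for t x q"
  "free_for t x (Or p q) \<longleftrightarrow> free_for t x p \<and> free_for t x q"
  by (auto simp: Imp_def Or_def)

lemma fv_numeral_trm [simp]: "fv_trm (numeral_trm n) = {}"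
  by (induction n) auto

lemma subst_trm_idle [simp]: "x \<notin> fv_trm t \<Longrightarrow> subst_trm x u t = t"
  by (induction t) auto

lemma subst_idle [simp]: "x \<notin> fv p \<Longrightarrow> subst x u p = p"
  by (induction p) auto

lemma subst_trm_Var_self [simp]: "subst_trm x (Var x) t = t"
  by (induction t) auto

lemma subst_Var_self [simp]: "subst x (Var x) p = p"
  by (induction p) auto

lemma free_for_Var_self [simp]: "free_for (Var x) x p"
  by (induction p) auto

lemma free_for_closed [simp]: "fv_trm t = {} \<Longrightarrow> free_for t x p"
  by (induction p) auto

text \<open>Propositional reasoning is done semantically: \<open>Taut\<close> admits every
  tautology, so a step costs one check over all valuations, which is left to automation.\<close>

lemma derives_taut0:
  assumes "\<And>v. prop_eval v p" shows "T \<turnstile> p"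
  using assms by (intro Taut) (simp add: tautology_def)

lemma derives_taut1:
  assumes "T \<turnstile> p" "\<And>v. prop_eval v p \<Longrightarrow> prop_eval v q"
  shows "T \<turnstile> q"
  by (rule MP[OF derives_taut0 assms(1)]) (use assms(2) in auto)

lemma derives_taut2:
  assumes "T \<turnstile> p" "T \<turnstile> q" "\<And>v. prop_eval v p \<Longrightarrow> prop_eval v q \<Longrightarrow> prop_eval v r"
  shows "T \<turnstile> r"
  by (rule MP[OF derives_taut1[OF assms(1)] assms(2)]) (use assms(3) in auto)

lemma derives_taut3:
  assumes "T \<turnstile> p" "T \<turnstile> q" "T \<turnstile> r"
    "\<And>v. prop_eval v p \<Longrightarrow> prop_eval v q \<Longrightarrow> prop_eval v r \<Longrightarrow> prop_eval v s"
  shows "T \<turnstile> s"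
  by (rule MP[OF derives_taut2[OF assms(1,2)] assms(3)]) (use assms(4) in auto)

lemma derives_subst:
  assumes "T \<turnstile> p" "free_for t x p" shows "T \<turnstile> subst x t p"
  using MP[OF Inst[OF assms(2)] Gen[OF assms(1)]] .

lemma derives_ExistsI:
  assumes "free_for t x p" shows "T \<turnstile> Imp (subst x t p) (Exists x p)"
  by (rule derives_taut1[OF Inst[of t x "Neg p"]]) (use assms in \<open>auto simp: Exists_def\<close>)

lemma derives_ExistsE:
  assumes "T \<turnstile> Imp p q" "x \<notin> fv q" shows "T \<turnstile> Imp (Exists x p) q"
proof -
  have "T \<turnstile> Forall x (Imp (Neg q) (Neg p))"
    by (intro Gen derives_taut1[OF assms(1)]) auto
  then have "T \<turnstile> Imp (Neg q) (Forall x (Neg p))"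
    using Distrib[of x "Neg q"] assms(2) MP by simp blast
  then show ?thesis by (rule derives_taut1) (auto simp: Exists_def)
qed

text \<open>Applying \<open>Leibniz\<close> to \<open>p\<close> and to \<open>Neg p\<close> yields
  both directions, without symmetry of equality.\<close>

lemma derives_Leibniz_Var:
  assumes "fv_trm t = {}"
  shows "T \<turnstile> Imp (Eq (Var x) t) (Iff p (subst x t p))"
  by (rule derives_taut2[OF Leibniz[of "Var x" x p t] Leibniz[of "Var x" x "Neg p" t]])
    (use assms in auto)

text \<open>Here and in the next two lemmas variable 0 marks the place of replacement in an instance
  of \<open>Leibniz\<close>; the side that must survive the replacement is therefore assumed
  closed.\<close>

lemma derives_Eq_sym:
  assumes "fv_trm s = {}" "T \<turnstile> Eq s t" shows "T \<turnstile> Eq t s"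
  using Leibniz[of s 0 "Eq (Var 0) s" t T] assms MP Refl by simp blast

lemma derives_Eq_trans:
  assumes "fv_trm s = {}" "T \<turnstile> Eq s t" "T \<turnstile> Eq t u" shows "T \<turnstile> Eq s u"
  using Leibniz[of t 0 "Eq s (Var 0)" u T] assms MP by simp blast

lemma derives_Eq_cong:
  assumes "fv_trm s = {}" "fv_trm t = {}" "T \<turnstile> Eq s t" "fv_trm (subst_trm 0 s c) = {}"
  shows "T \<turnstile> Eq (subst_trm 0 s c) (subst_trm 0 t c)"
  using Leibniz[of s 0 "Eq (subst_trm 0 s c) c" t T] assms MP Refl by simp blast

section \<open>Simultaneous substitution\<close>

primrec psubst_trm :: "(nat \<Rightarrow> trm) \<Rightarrow> trm \<Rightarrow> trm" where
  "psubst_trm \<sigma> (Var n) = \<sigma> n"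
| "psubst_trm \<sigma> Zero = Zero"
| "psubst_trm \<sigma> (Succ t) = Succ (psubst_trm \<sigma> t)"
| "psubst_trm \<sigma> (Add s t) = Add (psubst_trm \<sigma> s) (psubst_trm \<sigma> t)"
| "psubst_trm \<sigma> (Mult s t) = Mult (psubst_trm \<sigma> s) (psubst_trm \<sigma> t)"

text \<open>\<open>subst\<close> handles one variable, while the arguments below evaluate a formula
  under a whole assignment of numerals with a few variables left free.\<close>

primrec psubst :: "(nat \<Rightarrow> trm) \<Rightarrow> fm \<Rightarrow> fm" where
  "psubst \<sigma> (Eq s t) = Eq (psubst_trm \<sigma> s) (psubst_trm \<sigma> t)"
| "psubst \<sigma> (Neg p) = Neg (psubst \<sigma> p)"
| "psubst \<sigma> (And p q) = And (psubst \<sigma> p) (psubst \<sigma> q)"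
| "psubst \<sigma> (Forall n p) = Forall n (psubst (\<sigma>(n := Var n)) p)"

lemma psubst_connectives [simp]:
  "psubst \<sigma> (Imp p q) = Imp (psubst \<sigma> p) (psubst \<sigma> q)"
  "psubst \<sigma> (Or p q) = Or (psubst \<sigma> p) (psubst \<sigma> q)"
  "psubst \<sigma> (Iff p q) = Iff (psubst \<sigma> p) (psubst \<sigma> q)"
  "psubst \<sigma> (Exists n p) = Exists n (psubst (\<sigma>(n := Var n)) p)"
  by (auto simp: Imp_def Or_def Iff_def Exists_def)

lemma psubst_trm_closed [simp]: "fv_trm t = {} \<Longrightarrow> psubst_trm \<sigma> t = t"
  by (induction t) auto

lemma psubst_trm_Var: "psubst_trm Var t = t"
  by (induction t) auto

lemma psubst_Var: "psubst Var p = p"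
proof (induction p)
  case (Forall n p)
  have "Var(n := Var n) = Var" by auto
  with Forall show ?case by simp
qed (auto simp: psubst_trm_Var)

lemma fv_psubst_trm: "fv_trm (psubst_trm \<sigma> t) = (\<Union>x\<in>fv_trm t. fv_trm (\<sigma> x))"
  by (induction t) auto

text \<open>No capture can occur for such substitutions, so bound variables are never renamed.\<close>

definition grounding :: "(nat \<Rightarrow> trm) \<Rightarrow> bool" where
  "grounding \<sigma> \<longleftrightarrow> (\<forall>x. \<sigma> x = Var x \<or> fv_trm (\<sigma> x) = {})"

lemma grounding_simps [simp]:
  "grounding Var"
  "grounding \<sigma> \<Longrightarrow> grounding (\<sigma>(x := Var x))"
  "grounding \<sigma> \<Longrightarrow> fv_trm t = {} \<Longrightarrow> grounding (\<sigma>(x := t))"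
  by (auto simp: grounding_def)

lemma psubst_trm_psubst_trm: "psubst_trm \<sigma> (psubst_trm \<rho> t) = psubst_trm (\<lambda>x. psubst_trm \<sigma> (\<rho> x)) t"
  by (induction t) auto

text \<open>Only the inner substitution has to be grounding: below a quantifier over
  \<open>n\<close> the outer one is reset at \<open>n\<close>, which is harmless because
  \<open>\<rho> x\<close> does not contain \<open>n\<close> for \<open>x\<close> other than
  \<open>n\<close>.\<close>

lemma psubst_psubst:
  "grounding \<rho> \<Longrightarrow> psubst \<sigma> (psubst \<rho> p) = psubst (\<lambda>x. psubst_trm \<sigma> (\<rho> x)) p"
proof (induction p arbitrary: \<sigma> \<rho>)
  case (Forall n p)
  have eq: "(\<lambda>x. psubst_trm (\<sigma>(n := Var n)) ((\<rho>(n := Var n)) x)) = (\<lambda>x. psubst_trm \<sigma> (\<rho> x))(n := Var n)"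
  proof
    fix x
    show "psubst_trm (\<sigma>(n := Var n)) ((\<rho>(n := Var n)) x) = ((\<lambda>x. psubst_trm \<sigma> (\<rho> x))(n := Var n)) x"
      using Forall.prems[unfolded grounding_def, rule_format, of x] by auto
  qed
  show ?case
    by (simp only: psubst.simps Forall.IH[OF grounding_simps(2)[OF Forall.prems]] eq)
qed (auto simp: psubst_trm_psubst_trm)

lemma subst_trm_eq_psubst_trm: "subst_trm x t s = psubst_trm (Var(x := t)) s"
  by (induction s) auto

lemma subst_eq_psubst: "subst x t p = psubst (Var(x := t)) p"
proof (induction p)
  case (Forall n p)
  have "(Var(x := t))(n := Var n) = (if n = x then Var else Var(x := t))" by (rule ext) simp
  then show ?case
    by (cases "n = x") (simp_all only: subst.simps psubst.simps psubst_Var Forall.IH if_True if_False simp_thms)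
qed (simp_all only: subst.simps psubst.simps subst_trm_eq_psubst_trm)

text \<open>Quantifier rules and \<open>Leibniz\<close> speak of \<open>subst\<close>, evaluation
  under an assignment of \<open>psubst\<close>; freeing \<open>x\<close> first and filling it
  afterwards connects the two.\<close>

lemma subst_psubst:
  assumes "grounding \<sigma>" "fv_trm t = {}"
  shows "subst x t (psubst (\<sigma>(x := Var x)) p) = psubst (\<sigma>(x := t)) p"
proof -
  have "(\<lambda>y. psubst_trm (Var(x := t)) ((\<sigma>(x := Var x)) y)) = \<sigma>(x := t)"
  proof
    fix y
    show "psubst_trm (Var(x := t)) ((\<sigma>(x := Var x)) y) = (\<sigma>(x := t)) y"
      using assms(1)[unfolded grounding_def, rule_format, of y] by auto
  qed
  with assms show ?thesis by (simp add: subst_eq_psubst psubst_psubst)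
qed

lemma psubst_trm_cong: "(\<And>x. x \<in> fv_trm t \<Longrightarrow> \<sigma> x = \<rho> x) \<Longrightarrow> psubst_trm \<sigma> t = psubst_trm \<rho> t"
  by (induction t) auto

lemma psubst_cong: "(\<And>x. x \<in> fv p \<Longrightarrow> \<sigma> x = \<rho> x) \<Longrightarrow> psubst \<sigma> p = psubst \<rho> p"
proof (induction p arbitrary: \<sigma> \<rho>)
  case (Eq s t)
  then show ?case using psubst_trm_cong[of _ \<sigma> \<rho>] by simp
next
  case (Neg p)
  show ?case using Neg.IH[of \<sigma> \<rho>] Neg.prems by simp
next
  case (And p q)
  show ?case using And.IH[of \<sigma> \<rho>] And.prems by simp
next
  case (Forall n p)
  have "psubst (\<sigma>(n := Var n)) p = psubst (\<rho>(n := Var n)) p"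
    by (rule Forall.IH) (use Forall.prems in auto)
  then show ?case by (simp only: psubst.simps)
qed

lemma fv_psubst: "grounding \<sigma> \<Longrightarrow> fv (psubst \<sigma> p) = {x \<in> fv p. \<sigma> x = Var x}"
proof (induction p arbitrary: \<sigma>)
  case (Forall n p)
  from Forall.IH[OF grounding_simps(2)[OF Forall.prems]] show ?case
    by (simp only: psubst.simps fv.simps) auto
next
  case (Eq s t)
  have "fv_trm (\<sigma> x) = (if \<sigma> x = Var x then {x} else {})" for x
    using Eq by (auto simp: grounding_def)
  then show ?case by (auto simp: fv_psubst_trm split: if_splits)
qed auto

section \<open>Bounded quantifiers and least witnesses in extensions of R\<close>

primrec eval_trm :: "(nat \<Rightarrow> nat) \<Rightarrow> trm \<Rightarrow> nat" where
  "eval_trm e (Var n) = e n"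
| "eval_trm e Zero = 0"
| "eval_trm e (Succ t) = Suc (eval_trm e t)"
| "eval_trm e (Add s t) = eval_trm e s + eval_trm e t"
| "eval_trm e (Mult s t) = eval_trm e s * eval_trm e t"

definition nums :: "(nat \<Rightarrow> nat) \<Rightarrow> nat \<Rightarrow> trm" where
  "nums e x = numeral_trm (e x)"

lemma nums_upd: "nums (e(x := k)) = (nums e)(x := numeral_trm k)"
  by (auto simp: nums_def)

lemma grounding_nums [simp]: "grounding (nums e)"
  by (simp add: grounding_def nums_def)

lemma fv_psubst_trm_nums [simp]: "fv_trm (psubst_trm (nums e) t) = {}"
  by (simp add: fv_psubst_trm nums_def)

lemma fv_eq_some_upto [simp]: "fv (eq_some_upto t n) = fv_trm t"
  by (induction n) auto

lemma subst_eq_some_upto [simp]: "subst x s (eq_some_upto t n) = eq_some_upto (subst_trm x s t) n"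
  by (induction n) auto

lemma free_for_eq_some_upto [simp]: "free_for s x (eq_some_upto t n)"
  by (induction n) auto

lemma derives_eq_some_uptoE:
  assumes "\<And>k. k \<le> n \<Longrightarrow> T \<turnstile> Imp (Eq t (numeral_trm k)) q"
  shows "T \<turnstile> Imp (eq_some_upto t n) q"
  using assms
proof (induction n)
  case 0
  then show ?case by simp
next
  case (Suc n)
  then have "T \<turnstile> Imp (eq_some_upto t n) q" by simp
  from derives_taut2[OF this Suc.prems[of "Suc n"]] show ?case by auto
qed

text \<open>Needed because \<open>Le\<close> binds the least fresh variable, whereas the formulae
  below bind another one.\<close>

lemma derives_rename_Exists_Add:
  assumes "a \<notin> fv_trm s \<union> fv_trm t" "z \<notin> fv_trm s \<union> fv_trm t"
  shows "T \<turnstile> Imp (Exists a (Eq (Add (Var a) s) t)) (Exists z (Eq (Add (Var z) s) t))"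
proof (rule derives_ExistsE)
  show "T \<turnstile> Imp (Eq (Add (Var a) s) t) (Exists z (Eq (Add (Var z) s) t))"
    using derives_ExistsI[of "Var a" z "Eq (Add (Var z) s) t" T] assms by simp
qed (use assms in auto)

text \<open>The bound variable exceeds \<open>x\<close> and \<open>y\<close>, so it is fresh by
  arithmetic and, unlike the one in \<open>Le\<close>, does not change when terms are put in for
  them.\<close>

definition le_fm :: "nat \<Rightarrow> nat \<Rightarrow> fm" where
  "le_fm x y = Exists (Suc (x + y)) (Eq (Add (Var (Suc (x + y))) (Var x)) (Var y))"

definition bex :: "nat \<Rightarrow> nat \<Rightarrow> fm \<Rightarrow> fm" where
  "bex x y p = Exists x (And (le_fm x y) p)"

lemma psubst_le_fm [simp]:
  "psubst \<sigma> (le_fm x y) = Exists (Suc (x + y)) (Eq (Add (Var (Suc (x + y))) (\<sigma> x)) (\<sigma> y))"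
  by (simp add: le_fm_def)

lemma psubst_bex:
  "x \<noteq> y \<Longrightarrow> psubst \<sigma> (bex x y p) =
    Exists x (And (Exists (Suc (x + y)) (Eq (Add (Var (Suc (x + y))) (Var x)) (\<sigma> y)))
      (psubst (\<sigma>(x := Var x)) p))"
  by (simp add: bex_def)

lemma Le_Var_numeral: "Le (Var 0) (numeral_trm n) = Exists 1 (Eq (Add (Var 1) (Var 0)) (numeral_trm n))"
proof -
  have "(LEAST z::nat. z \<notin> fv_trm (Var 0) \<union> fv_trm (numeral_trm n)) = 1"
    by (rule Least_equality) auto
  then show ?thesis by (simp add: Le_def)
qed

lemma Le_numeral_Var: "Le (numeral_trm n) (Var 0) = Exists 1 (Eq (Add (Var 1) (numeral_trm n)) (Var 0))"
proof -
  have "(LEAST z::nat. z \<notin> fv_trm (numeral_trm n) \<union> fv_trm (Var 0)) = 1"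
    by (rule Least_equality) auto
  then show ?thesis by (simp add: Le_def)
qed

locale R_theory =
  fixes T :: "fm set"
  assumes extends_R: "extends T theory_R"
begin

section \<open>What R proves about numerals and the order\<close>

lemma numeral_Add: "T \<turnstile> Eq (Add (numeral_trm m) (numeral_trm n)) (numeral_trm (m + n))"
  using extends_R unfolding extends_def theory_R_def by blast

lemma numeral_Mult: "T \<turnstile> Eq (Mult (numeral_trm m) (numeral_trm n)) (numeral_trm (m * n))"
  using extends_R unfolding extends_def theory_R_def by blast

lemma numeral_neq: "m \<noteq> n \<Longrightarrow> T \<turnstile> Neg (Eq (numeral_trm m) (numeral_trm n))"
  using extends_R unfolding extends_def theory_R_def by blast

lemma le_numeral_cases:
  assumes "z \<noteq> x"
  shows "T \<turnstile> Imp (Eq (Add (Var z) (Var x)) (numeral_trm n)) (eq_some_upto (Var x) n)"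
proof -
  have "T \<turnstile> Imp (Le (Var 0) (numeral_trm n)) (eq_some_upto (Var 0) n)"
    using extends_R unfolding extends_def theory_R_def by blast
  then have ax: "T \<turnstile> Imp (Eq (Add (Var 1) (Var 0)) (numeral_trm n)) (eq_some_upto (Var 0) n)"
    by (rule derives_taut2[OF _ derives_ExistsI[of "Var 1" 1 "Eq (Add (Var 1) (Var 0)) (numeral_trm n)"]])
      (simp_all add: Le_Var_numeral)
  \<comment> \<open>The detour through \<open>w\<close> avoids a clash between the renamings of 0 to
    \<open>x\<close> and 1 to \<open>z\<close>, which would occur in one order for
    \<open>x = 1\<close> and in the other for \<open>z = 0\<close>.\<close>
  obtain w where w: "w \<notin> {0, 1, x, z}"
    using ex_new_if_finite[of "{0, 1, x, z}"] by auto
  have "T \<turnstile> subst w (Var z) (subst 0 (Var x) (subst 1 (Var w)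
    (Imp (Eq (Add (Var 1) (Var 0)) (numeral_trm n)) (eq_some_upto (Var 0) n))))"
    by (intro derives_subst ax) auto
  then show ?thesis using w assms by simp
qed

text \<open>The condition \<open>x \<noteq> 1\<close> prevents capture: 1 is the variable bound in
  both occurrences of \<open>Le\<close>. It is the reason why \<open>u\<close> is kept away from 1
  later on.\<close>

lemma le_numeral_total:
  assumes "x \<noteq> 1" "z \<noteq> x"
  shows "T \<turnstile> Or (Exists z (Eq (Add (Var z) (Var x)) (numeral_trm n)))
    (Exists z (Eq (Add (Var z) (numeral_trm n)) (Var x)))"
proof -
  have "T \<turnstile> Or (Le (Var 0) (numeral_trm n)) (Le (numeral_trm n) (Var 0))"
    using extends_R unfolding extends_def theory_R_def by blast
  then have "T \<turnstile> subst 0 (Var x) (Or (Le (Var 0) (numeral_trm n)) (Le (numeral_trm n) (Var 0)))"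
    by (rule derives_subst) (use assms in \<open>auto simp: Le_Var_numeral Le_numeral_Var Exists_def\<close>)
  then have "T \<turnstile> Or (Exists 1 (Eq (Add (Var 1) (Var x)) (numeral_trm n)))
    (Exists 1 (Eq (Add (Var 1) (numeral_trm n)) (Var x)))"
    using assms by (simp add: Le_Var_numeral Le_numeral_Var)
  then show ?thesis
    by (rule derives_taut3[OF _ derives_rename_Exists_Add[of 1 "Var x" "numeral_trm n" z]
          derives_rename_Exists_Add[of 1 "numeral_trm n" "Var x" z]])
      (use assms in auto)
qed

text \<open>R knows \<open>+\<close> and \<open>*\<close> only through their values at numerals, so
  a closed term is evaluated from the inside out, each subterm being replaced by its
  numeral.\<close>

lemma term_value: "T \<turnstile> Eq (psubst_trm (nums e) t) (numeral_trm (eval_trm e t))"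
proof (induction t)
  case (Var n)
  show ?case by (simp add: nums_def Refl)
next
  case Zero
  show ?case by (simp add: Refl)
next
  case (Succ t)
  from derives_Eq_cong[OF _ _ this, of "Succ (Var 0)"] show ?case by simp
next
  case (Add s t)
  have "T \<turnstile> Eq (Add (psubst_trm (nums e) s) (psubst_trm (nums e) t))
      (Add (numeral_trm (eval_trm e s)) (psubst_trm (nums e) t))"
    using derives_Eq_cong[OF _ _ Add.IH(1), of "Add (Var 0) (psubst_trm (nums e) t)"] by simp
  moreover have "T \<turnstile> Eq (Add (numeral_trm (eval_trm e s)) (psubst_trm (nums e) t))
      (Add (numeral_trm (eval_trm e s)) (numeral_trm (eval_trm e t)))"
    using derives_Eq_cong[OF _ _ Add.IH(2), of "Add (numeral_trm (eval_trm e s)) (Var 0)"] by simp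
  ultimately show ?case
    using derives_Eq_trans[OF _ _ derives_Eq_trans[OF _ _ numeral_Add]] by simp
next
  case (Mult s t)
  have "T \<turnstile> Eq (Mult (psubst_trm (nums e) s) (psubst_trm (nums e) t))
      (Mult (numeral_trm (eval_trm e s)) (psubst_trm (nums e) t))"
    using derives_Eq_cong[OF _ _ Mult.IH(1), of "Mult (Var 0) (psubst_trm (nums e) t)"] by simp
  moreover have "T \<turnstile> Eq (Mult (numeral_trm (eval_trm e s)) (psubst_trm (nums e) t))
      (Mult (numeral_trm (eval_trm e s)) (numeral_trm (eval_trm e t)))"
    using derives_Eq_cong[OF _ _ Mult.IH(2), of "Mult (numeral_trm (eval_trm e s)) (Var 0)"] by simp
  ultimately show ?case
    using derives_Eq_trans[OF _ _ derives_Eq_trans[OF _ _ numeral_Mult]] by simp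
qed

lemma Eq_true:
  assumes "eval_trm e s = eval_trm e t"
  shows "T \<turnstile> psubst (nums e) (Eq s t)"
  using derives_Eq_trans[OF _ term_value[of e s] derives_Eq_sym[OF _ term_value[of e t, folded assms]]]
  by simp

lemma Eq_false:
  assumes "eval_trm e s \<noteq> eval_trm e t"
  shows "T \<turnstile> Neg (psubst (nums e) (Eq s t))"
proof -
  let ?s = "psubst_trm (nums e) s" and ?t = "psubst_trm (nums e) t"
  let ?m = "numeral_trm (eval_trm e s)" and ?n = "numeral_trm (eval_trm e t)"
  have "T \<turnstile> Imp (Eq ?s ?t) (Eq ?m ?t)"
    using MP[OF Leibniz[of ?s 0 "Eq (Var 0) ?t" ?m] term_value] by simp
  moreover have "T \<turnstile> Imp (Eq ?m ?t) (Eq ?m ?n)"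
    using MP[OF Leibniz[of ?t 0 "Eq ?m (Var 0)" ?n] term_value] by simp
  ultimately show ?thesis
    by (rule derives_taut3[OF _ _ numeral_neq[OF assms]]) auto
qed

lemma le_true:
  assumes "k \<le> n" shows "T \<turnstile> Exists z (Eq (Add (Var z) (numeral_trm k)) (numeral_trm n))"
proof (rule MP[OF derives_ExistsI])
  show "T \<turnstile> subst z (numeral_trm (n - k)) (Eq (Add (Var z) (numeral_trm k)) (numeral_trm n))"
    using numeral_Add[of "n - k" k] assms by simp
qed simp

section \<open>Bounded quantification below a numeral\<close>

lemma bex_intro:
  assumes "grounding \<sigma>" "x \<noteq> y" "\<sigma> y = numeral_trm n" "k \<le> n"
    "T \<turnstile> psubst (\<sigma>(x := numeral_trm k)) p"
  shows "T \<turnstile> psubst \<sigma> (bex x y p)"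
  unfolding psubst_bex[OF assms(2)]
proof (rule MP[OF derives_ExistsI])
  let ?q = "And (Exists (Suc (x + y)) (Eq (Add (Var (Suc (x + y))) (Var x)) (\<sigma> y)))
    (psubst (\<sigma>(x := Var x)) p)"
  have "subst x (numeral_trm k) ?q =
    And (Exists (Suc (x + y)) (Eq (Add (Var (Suc (x + y))) (numeral_trm k)) (numeral_trm n)))
      (psubst (\<sigma>(x := numeral_trm k)) p)"
    using assms by (simp add: subst_psubst)
  then show "T \<turnstile> subst x (numeral_trm k) ?q"
    using derives_taut2[OF le_true[OF assms(4)] assms(5)] by simp
qed simp

text \<open>The finite disjunction that R grants below a numeral turns the quantifier into a case
  split over \<open>k \<le> n\<close>, valid in nonstandard models as well.\<close>

lemma bex_elim:
  assumes "grounding \<sigma>" "x \<noteq> y" "\<sigma> y = numeral_trm n" "x \<notin> fv q"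
    "\<And>k. k \<le> n \<Longrightarrow> T \<turnstile> Imp (psubst (\<sigma>(x := numeral_trm k)) p) q"
  shows "T \<turnstile> Imp (psubst \<sigma> (bex x y p)) q"
  unfolding psubst_bex[OF assms(2)]
proof (rule derives_ExistsE)
  let ?p = "psubst (\<sigma>(x := Var x)) p" and ?z = "Suc (x + y)"
  have "T \<turnstile> Imp (Eq (Var x) (numeral_trm k)) (Imp ?p q)" if "k \<le> n" for k
    using derives_taut2[OF derives_Leibniz_Var[of "numeral_trm k" T x ?p] assms(5)[OF that]]
    by (simp add: subst_psubst assms)
  then have "T \<turnstile> Imp (eq_some_upto (Var x) n) (Imp ?p q)"
    by (rule derives_eq_some_uptoE)
  moreover have "T \<turnstile> Imp (Exists ?z (Eq (Add (Var ?z) (Var x)) (\<sigma> y))) (eq_some_upto (Var x) n)"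
    by (rule derives_ExistsE) (use le_numeral_cases[of ?z x n] assms(3) in auto)
  ultimately show "T \<turnstile> Imp (And (Exists ?z (Eq (Add (Var ?z) (Var x)) (\<sigma> y))) ?p) q"
    by (rule derives_taut2) auto
qed (fact assms(4))

lemma bex_refute:
  assumes "grounding \<sigma>" "x \<noteq> y" "\<sigma> y = numeral_trm n"
    "\<And>k. k \<le> n \<Longrightarrow> T \<turnstile> Neg (psubst (\<sigma>(x := numeral_trm k)) p)"
  shows "T \<turnstile> Neg (psubst \<sigma> (bex x y p))"
\<comment> \<open>\<open>Neg (Eq Zero Zero)\<close> serves as falsum, refuted by
  \<open>Refl\<close>.\<close>
proof (rule derives_taut2[OF bex_elim[OF assms(1-3), of "Neg (Eq Zero Zero)" p] Refl[of T Zero]])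
  show "T \<turnstile> Imp (psubst (\<sigma>(x := numeral_trm k)) p) (Neg (Eq Zero Zero))" if "k \<le> n" for k
    by (rule derives_taut1[OF assms(4)[OF that]]) auto
qed auto

text \<open>The formula says that \<open>u\<close> is the least \<open>w\<close> satisfying \<open>q\<close>; its uniqueness half is provable even
  at nonstandard \<open>u\<close>, because \<open>u\<close> is compared with the standard least witness.\<close>

definition least_fm :: "nat \<Rightarrow> nat \<Rightarrow> fm \<Rightarrow> fm" where
  "least_fm w u q = Neg (bex w u (Neg (Iff q (Eq (Var w) (Var u)))))"

text \<open>Compare \<open>u\<close> with \<open>n\<close>. If \<open>u \<le> n\<close>, then
  \<open>u\<close> is a numeral \<open>k\<close>, and \<open>k < n\<close> is impossible as
  \<open>q\<close> fails there. If \<open>n \<le> u\<close>, the bounded quantifier in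
  \<open>least_fm\<close> applies to the standard number \<open>n\<close>, where \<open>q\<close>
  holds, and returns \<open>n = u\<close>; nothing more has to be known about
  \<open>u\<close>.\<close>

lemma least_fm_iff:
  assumes g: "grounding \<sigma>" and u: "\<sigma> u = Var u" "u \<noteq> w" "u \<noteq> 1" "u \<notin> fv q"
    and yes: "T \<turnstile> psubst (\<sigma>(w := numeral_trm n)) q"
    and no: "\<And>k. k < n \<Longrightarrow> T \<turnstile> Neg (psubst (\<sigma>(w := numeral_trm k)) q)"
  shows "T \<turnstile> Iff (psubst \<sigma> (least_fm w u q)) (Eq (Var u) (numeral_trm n))"
proof -
  let ?L = "psubst \<sigma> (least_fm w u q)" and ?z = "Suc (w + u)"
  have su: "\<sigma>(u := Var u) = \<sigma>" using u by auto
  have q_upd: "psubst (\<sigma>(u := t, w := s)) q = psubst (\<sigma>(w := s)) q" for s t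
    by (rule psubst_cong) (use u in auto)
  have L_num: "subst u (numeral_trm k) ?L = psubst (\<sigma>(u := numeral_trm k)) (least_fm w u q)" for k
    using subst_psubst[OF g, of "numeral_trm k" u "least_fm w u q"] su by simp
  have "T \<turnstile> psubst (\<sigma>(u := numeral_trm n)) (least_fm w u q)"
    unfolding least_fm_def psubst.simps
  proof (rule bex_refute[of _ _ _ n])
    fix k assume "k \<le> n"
    then consider "k = n" | "k < n" by linarith
    then have "T \<turnstile> Iff (psubst (\<sigma>(w := numeral_trm k)) q) (Eq (numeral_trm k) (numeral_trm n))"
    proof cases
      case 1
      then show ?thesis using derives_taut2[OF yes Refl[of T "numeral_trm n"]] by simp
    next
      case 2
      then show ?thesis by (intro derives_taut2[OF no[of k] numeral_neq[of k n]]) auto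
    qed
    from derives_taut1[OF this]
    show "T \<turnstile> Neg (psubst (\<sigma>(u := numeral_trm n, w := numeral_trm k)) (Neg (Iff q (Eq (Var w) (Var u)))))"
      using u by (simp add: q_upd)
  qed (use g u in auto)
  with derives_Leibniz_Var[of "numeral_trm n" T u ?L]
  have 1: "T \<turnstile> Imp (Eq (Var u) (numeral_trm n)) ?L"
    unfolding L_num by (rule derives_taut2) auto
  have "T \<turnstile> Imp (Eq (Var u) (numeral_trm k)) (Imp ?L (Eq (Var u) (numeral_trm n)))" if "k \<le> n" for k
  proof (cases "k = n")
    case True
    then show ?thesis by (intro derives_taut0) auto
  next
    case False
    with that have "k < n" by simp
    \<comment> \<open>The instance \<open>w = u = k\<close> breaks the biconditional: the equation
      holds and \<open>q\<close> fails.\<close>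
    then have "T \<turnstile> psubst (\<sigma>(u := numeral_trm k, w := numeral_trm k)) (Neg (Iff q (Eq (Var w) (Var u))))"
      using derives_taut2[OF no[of k] Refl[of T "numeral_trm k"]] u by (simp add: q_upd)
    then have "T \<turnstile> psubst (\<sigma>(u := numeral_trm k)) (bex w u (Neg (Iff q (Eq (Var w) (Var u)))))"
      by (intro bex_intro[of _ _ _ k k]) (use g u in auto)
    then have "T \<turnstile> Neg (subst u (numeral_trm k) ?L)"
      unfolding L_num unfolding least_fm_def by (rule derives_taut1) simp
    with derives_Leibniz_Var[of "numeral_trm k" T u ?L] show ?thesis
      by (rule derives_taut2) auto
  qed
  then have "T \<turnstile> Imp (eq_some_upto (Var u) n) (Imp ?L (Eq (Var u) (numeral_trm n)))"
    by (rule derives_eq_some_uptoE)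
  moreover have "T \<turnstile> Imp (Exists ?z (Eq (Add (Var ?z) (Var u)) (numeral_trm n))) (eq_some_upto (Var u) n)"
    by (rule derives_ExistsE) (use le_numeral_cases[of ?z u n] in auto)
  ultimately have 2: "T \<turnstile> Imp (Exists ?z (Eq (Add (Var ?z) (Var u)) (numeral_trm n)))
      (Imp ?L (Eq (Var u) (numeral_trm n)))"
    by (rule derives_taut2) auto
  have 3: "T \<turnstile> Imp (Exists ?z (Eq (Add (Var ?z) (numeral_trm n)) (Var u)))
      (Imp ?L (Eq (Var u) (numeral_trm n)))"
  proof -
    let ?b = "And (Exists ?z (Eq (Add (Var ?z) (Var w)) (Var u)))
      (psubst (\<sigma>(w := Var w)) (Neg (Iff q (Eq (Var w) (Var u)))))"
    have b: "T \<turnstile> Imp (subst w (numeral_trm n) ?b) (Exists w ?b)"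
      by (rule derives_ExistsI) simp
    have L: "?L = Neg (Exists w ?b)"
      using u by (simp add: least_fm_def psubst_bex)
    have b_num: "subst w (numeral_trm n) ?b = And (Exists ?z (Eq (Add (Var ?z) (numeral_trm n)) (Var u)))
      (Neg (Iff (psubst (\<sigma>(w := numeral_trm n)) q) (Eq (numeral_trm n) (Var u))))"
      using u g by (simp add: subst_psubst)
    have "T \<turnstile> Imp (Exists ?z (Eq (Add (Var ?z) (numeral_trm n)) (Var u)))
      (Imp ?L (Eq (numeral_trm n) (Var u)))"
      unfolding L by (rule derives_taut2[OF yes b[unfolded b_num]]) auto
    moreover have "T \<turnstile> Imp (Eq (numeral_trm n) (Var u)) (Eq (Var u) (numeral_trm n))"
      using derives_taut2[OF Leibniz[of "numeral_trm n" w "Eq (Var w) (numeral_trm n)" "Var u" T]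
          Refl[of T "numeral_trm n"]] by simp
    ultimately show ?thesis by (rule derives_taut2) auto
  qed
  have "T \<turnstile> Imp ?L (Eq (Var u) (numeral_trm n))"
    by (rule derives_taut3[OF le_numeral_total[of u ?z n] 2 3]) (use u in auto)
  with 1 show ?thesis by (rule derives_taut2) auto
qed

section \<open>Decided and existentially definable predicates\<close>

text \<open>Predicates of assignments of numbers to variables stand in for formulae evaluated in the
  standard model: \<open>Delta\<close> plays the role of the bounded formulae and \<open>Sigma\<close> that of their
  existential closures.\<close>

definition decides :: "fm \<Rightarrow> ((nat \<Rightarrow> nat) \<Rightarrow> bool) \<Rightarrow> bool" where
  "decides p P \<longleftrightarrow>
    (\<forall>e. (P e \<longrightarrow> T \<turnstile> psubst (nums e) p) \<and> (\<not> P e \<longrightarrow> T \<turnstile> Neg (psubst (nums e) p)))"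

definition Delta :: "((nat \<Rightarrow> nat) \<Rightarrow> bool) \<Rightarrow> bool" where
  "Delta P \<longleftrightarrow> (\<exists>p. decides p P)"

lemma decidesI:
  assumes "\<And>e. P e \<Longrightarrow> T \<turnstile> psubst (nums e) p" "\<And>e. \<not> P e \<Longrightarrow> T \<turnstile> Neg (psubst (nums e) p)"
  shows "decides p P"
  using assms by (simp add: decides_def)

lemma decides_true: "decides p P \<Longrightarrow> P e \<Longrightarrow> T \<turnstile> psubst (nums e) p"
  by (simp add: decides_def)

lemma decides_false: "decides p P \<Longrightarrow> \<not> P e \<Longrightarrow> T \<turnstile> Neg (psubst (nums e) p)"
  by (simp add: decides_def)

lemma decides_bex:
  assumes "decides p P" "x \<noteq> y"
  shows "decides (bex x y p) (\<lambda>e. \<exists>k\<le>e y. P (e(x := k)))"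
proof (rule decidesI)
  fix e
  assume "\<exists>k\<le>e y. P (e(x := k))"
  then obtain k where k: "k \<le> e y" "P (e(x := k))" by blast
  show "T \<turnstile> psubst (nums e) (bex x y p)"
    using bex_intro[of "nums e" x y "e y" k p] assms(2) k(1) decides_true[OF assms(1), OF k(2)]
    by (simp add: nums_upd nums_def[of e y])
next
  fix e
  assume *: "\<not> (\<exists>k\<le>e y. P (e(x := k)))"
  show "T \<turnstile> Neg (psubst (nums e) (bex x y p))"
  proof (rule bex_refute[of "nums e" x y "e y"])
    fix k assume "k \<le> e y"
    with * have "\<not> P (e(x := k))" by blast
    from decides_false[OF assms(1), OF this] show "T \<turnstile> Neg (psubst ((nums e)(x := numeral_trm k)) p)"
      by (simp only: nums_upd)
  qed (simp_all add: assms nums_def[of e y])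
qed

section \<open>Closure properties of decided predicates\<close>

lemma Delta_Eq: "Delta (\<lambda>e. eval_trm e s = eval_trm e t)"
  unfolding Delta_def by (intro exI[of _ "Eq s t"] decidesI Eq_true Eq_false)

lemma Delta_not: "Delta P \<Longrightarrow> Delta (\<lambda>e. \<not> P e)"
proof -
  assume "Delta P"
  then obtain p where p: "decides p P" by (auto simp: Delta_def)
  have "T \<turnstile> Neg (psubst (nums e) (Neg p))" if "P e" for e
    by (rule derives_taut1[OF decides_true[OF p, OF that]]) simp
  then have "decides (Neg p) (\<lambda>e. \<not> P e)"
    using decides_false[OF p] by (intro decidesI) auto
  then show ?thesis by (auto simp: Delta_def)
qed

lemma Delta_conj:
  assumes "Delta P" "Delta Q" shows "Delta (\<lambda>e. P e \<and> Q e)"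
proof -
  obtain p q where p: "decides p P" and q: "decides q Q" using assms by (auto simp: Delta_def)
  have "decides (And p q) (\<lambda>e. P e \<and> Q e)"
  proof (rule decidesI)
    fix e assume "P e \<and> Q e"
    then show "T \<turnstile> psubst (nums e) (And p q)"
      by (intro derives_taut2[OF decides_true[OF p] decides_true[OF q], of e e]) auto
  next
    fix e assume "\<not> (P e \<and> Q e)"
    then consider "\<not> P e" | "\<not> Q e" by blast
    then show "T \<turnstile> Neg (psubst (nums e) (And p q))"
      by cases (auto intro: derives_taut1[OF decides_false[OF p]] derives_taut1[OF decides_false[OF q]])
  qed
  then show ?thesis by (auto simp: Delta_def)
qed

lemma Delta_bex: "Delta P \<Longrightarrow> x \<noteq> y \<Longrightarrow> Delta (\<lambda>e. \<exists>k\<le>e y. P (e(x := k)))"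
  unfolding Delta_def using decides_bex by blast

lemma Delta_ball:
  assumes "Delta P" "x \<noteq> y" shows "Delta (\<lambda>e. \<forall>k<e y. P (e(x := k)))"
proof -
  \<comment> \<open>The strict bound is \<open>k \<le> e y\<close> together with
    \<open>k \<noteq> e y\<close>, the latter written with terms so that \<open>Delta_Eq\<close>
    applies.\<close>
  have "Delta (\<lambda>e. \<not> (\<exists>k\<le>e y. \<not> P (e(x := k)) \<and> \<not> eval_trm (e(x := k)) (Var x) = eval_trm (e(x := k)) (Var y)))"
    by (intro Delta_not Delta_bex[of "\<lambda>e. \<not> P e \<and> \<not> eval_trm e (Var x) = eval_trm e (Var y)"]
        Delta_conj Delta_Eq assms)
  moreover have "(\<lambda>e. \<not> (\<exists>k\<le>e y. \<not> P (e(x := k)) \<and> \<not> eval_trm (e(x := k)) (Var x) = eval_trm (e(x := k)) (Var y)))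
    = (\<lambda>e. \<forall>k<e y. P (e(x := k)))"
    using assms(2) by (auto simp: fun_eq_iff le_less)
  ultimately show ?thesis by simp
qed

text \<open>The existential witness and its bound can be placed in any fresh variable, and the matrix is
  monotone in it, so that several predicates can share one witness variable.\<close>

definition witnesses ::
  "nat \<Rightarrow> ((nat \<Rightarrow> nat) \<Rightarrow> bool) \<Rightarrow> ((nat \<Rightarrow> nat) \<Rightarrow> bool) \<Rightarrow> bool" where
  "witnesses z Q P \<longleftrightarrow> (\<forall>e. P e \<longleftrightarrow> (\<exists>m. Q (e(z := m)))) \<and>
     (\<forall>e m n. m \<le> n \<longrightarrow> Q (e(z := m)) \<longrightarrow> Q (e(z := n)))"

text \<open>A semantic predicate has no syntactic free variables, so freshness of \<open>z\<close>
  becomes avoidance of some finite set.\<close>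

definition Sigma :: "((nat \<Rightarrow> nat) \<Rightarrow> bool) \<Rightarrow> bool" where
  "Sigma P \<longleftrightarrow> (\<exists>F. finite F \<and> (\<forall>z. z \<notin> F \<longrightarrow> (\<exists>Q. Delta Q \<and> witnesses z Q P)))"

lemma witnessesI:
  assumes "\<And>e. P e \<longleftrightarrow> (\<exists>m. Q (e(z := m)))"
    "\<And>e m n. m \<le> n \<Longrightarrow> Q (e(z := m)) \<Longrightarrow> Q (e(z := n))"
  shows "witnesses z Q P"
  using assms unfolding witnesses_def by blast

lemma witnessesD:
  assumes "witnesses z Q P"
  shows "P e \<longleftrightarrow> (\<exists>m. Q (e(z := m)))"
    and "m \<le> n \<Longrightarrow> Q (e(z := m)) \<Longrightarrow> Q (e(z := n))"
  using assms unfolding witnesses_def by blast+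

lemma SigmaI:
  assumes "finite F" "\<And>z. z \<notin> F \<Longrightarrow> \<exists>Q. Delta Q \<and> witnesses z Q P"
  shows "Sigma P"
  using assms unfolding Sigma_def by blast

lemma finite_fv_trm [simp]: "finite (fv_trm t)"
  by (induction t) auto

lemma finite_fv [simp]: "finite (fv p)"
  by (induction p) auto

lemma eval_trm_upd [simp]: "x \<notin> fv_trm t \<Longrightarrow> eval_trm (e(x := k)) t = eval_trm e t"
  by (induction t) auto

section \<open>Closure properties of existentially definable predicates\<close>

lemma Sigma_Eq: "Sigma (\<lambda>e. eval_trm e s = eval_trm e t)"
  by (rule SigmaI[of "fv_trm s \<union> fv_trm t"]) (use Delta_Eq[of s t] in \<open>auto simp: witnesses_def\<close>)

lemma Sigma_conj:
  assumes "Sigma P" "Sigma Q" shows "Sigma (\<lambda>e. P e \<and> Q e)"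
proof -
  obtain F where F: "finite F" "\<And>z. z \<notin> F \<Longrightarrow> \<exists>R. Delta R \<and> witnesses z R P"
    using assms(1) unfolding Sigma_def by blast
  obtain G where G: "finite G" "\<And>z. z \<notin> G \<Longrightarrow> \<exists>R. Delta R \<and> witnesses z R Q"
    using assms(2) unfolding Sigma_def by blast
  show ?thesis
  proof (rule SigmaI[of "F \<union> G"])
    fix z assume z: "z \<notin> F \<union> G"
    obtain R where R: "Delta R" "witnesses z R P" using F(2)[of z] z by auto
    note Rw = witnessesD[OF R(2)]
    obtain S where S: "Delta S" "witnesses z S Q" using G(2)[of z] z by auto
    note Sw = witnessesD[OF S(2)]
    have "P e \<and> Q e \<longleftrightarrow> (\<exists>m. R (e(z := m)) \<and> S (e(z := m)))" for e
    proof
      assume "P e \<and> Q e"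
      then obtain m n where "R (e(z := m))" "S (e(z := n))" using Rw(1) Sw(1) by auto
      then have "R (e(z := max m n)) \<and> S (e(z := max m n))"
        using Rw(2)[of m "max m n"] Sw(2)[of n "max m n"] by simp
      then show "\<exists>m. R (e(z := m)) \<and> S (e(z := m))" by blast
    qed (use Rw(1) Sw(1) in blast)
    then have "witnesses z (\<lambda>e. R e \<and> S e) (\<lambda>e. P e \<and> Q e)"
      using Rw(2) Sw(2) by (intro witnessesI) blast+
    with Delta_conj[OF R(1) S(1)] show "\<exists>R. Delta R \<and> witnesses z R (\<lambda>e. P e \<and> Q e)" by blast
  qed (use F G in auto)
qed

text \<open>The one variable \<open>z\<close> bounds both the quantified value and the old witness,
  so two unbounded quantifiers merge without a pairing function.\<close>

lemma Sigma_ex: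
  assumes "Sigma P" shows "Sigma (\<lambda>e. \<exists>k. P (e(x := k)))"
proof -
  obtain F where F: "finite F" "\<And>z. z \<notin> F \<Longrightarrow> \<exists>R. Delta R \<and> witnesses z R P"
    using assms(1) unfolding Sigma_def by blast
  show ?thesis
  proof (rule SigmaI[of "insert x F"])
    fix z assume z: "z \<notin> insert x F"
    obtain R where R: "Delta R" "witnesses z R P" using F(2)[of z] z by auto
    note Rw = witnessesD[OF R(2)]
    let ?S = "\<lambda>e. \<exists>k\<le>e z. R (e(x := k))"
    have tw: "e(z := m, x := k) = e(x := k, z := m)" for e :: "nat \<Rightarrow> nat" and m k
      using z by (simp add: fun_upd_twist)
    have "(\<exists>k. P (e(x := k))) \<longleftrightarrow> (\<exists>m. ?S (e(z := m)))" for e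
    proof
      assume "\<exists>k. P (e(x := k))"
      then obtain k m where "R (e(x := k, z := m))" using Rw(1) by blast
      then have "R (e(x := k, z := max k m))" using Rw(2)[of m "max k m" "e(x := k)"] by simp
      then have "?S (e(z := max k m))" by (auto simp: tw intro!: exI[of _ k])
      then show "\<exists>m. ?S (e(z := m))" by blast
    qed (use Rw(1) in \<open>auto simp: tw\<close>)
    moreover have "?S (e(z := n))" if "m \<le> n" "?S (e(z := m))" for e m n
    proof -
      from that(2)
      obtain k where "k \<le> m" "R (e(x := k, z := m))" by (auto simp: tw)
      with Rw(2)[OF that(1)] that(1) show "?S (e(z := n))" by (auto simp: tw intro!: exI[of _ k])
    qed
    ultimately have "witnesses z ?S (\<lambda>e. \<exists>k. P (e(x := k)))"
      by (intro witnessesI) blast+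
    moreover have "Delta ?S" using z by (intro Delta_bex R(1)) auto
    ultimately show "\<exists>R. Delta R \<and> witnesses z R (\<lambda>e. \<exists>k. P (e(x := k)))" by blast
  qed (use F in auto)
qed

text \<open>Collection, carried out in the natural numbers: finitely many witnesses have a maximum,
  and monotonicity lets it serve for all of them. Nothing is asked of \<open>T\<close>.\<close>

lemma Sigma_ball:
  assumes "Sigma P" "x \<noteq> y" shows "Sigma (\<lambda>e. \<forall>k<e y. P (e(x := k)))"
proof -
  obtain F where F: "finite F" "\<And>z. z \<notin> F \<Longrightarrow> \<exists>R. Delta R \<and> witnesses z R P"
    using assms(1) unfolding Sigma_def by blast
  show ?thesis
  proof (rule SigmaI[of "F \<union> {x, y}"])
    fix z assume z: "z \<notin> F \<union> {x, y}"
    obtain R where R: "Delta R" "witnesses z R P" using F(2)[of z] z by auto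
    note Rw = witnessesD[OF R(2)]
    let ?S = "\<lambda>e. \<forall>k<e y. R (e(x := k))"
    have tw: "e(z := m, x := k) = e(x := k, z := m)" for e :: "nat \<Rightarrow> nat" and m k
      using z by (simp add: fun_upd_twist)
    have "(\<forall>k<e y. P (e(x := k))) \<longleftrightarrow> (\<exists>m. ?S (e(z := m)))" for e
    proof
      assume "\<forall>k<e y. P (e(x := k))"
      then obtain g where g: "\<And>k. k < e y \<Longrightarrow> R (e(x := k, z := g k))"
        unfolding Rw(1) by metis
      have "R (e(x := k, z := Max (g ` {..<e y})))" if "k < e y" for k
        by (rule Rw(2)[OF _ g[OF that]]) (use that in auto)
      \<comment> \<open>For \<open>e y = 0\<close> the maximum is taken over the empty set; its
        value is irrelevant, as no \<open>k\<close> is in range.\<close>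
      then have "?S (e(z := Max (g ` {..<e y})))" using z by (auto simp: tw)
      then show "\<exists>m. ?S (e(z := m))" by blast
    qed (use Rw(1) z in \<open>auto simp: tw\<close>)
    moreover have "?S (e(z := m)) \<Longrightarrow> ?S (e(z := n))" if "m \<le> n" for e m n
      using Rw(2)[OF that] z by (auto simp: tw)
    ultimately have "witnesses z ?S (\<lambda>e. \<forall>k<e y. P (e(x := k)))"
      by (intro witnessesI) blast+
    with Delta_ball[OF R(1) assms(2)]
    show "\<exists>R. Delta R \<and> witnesses z R (\<lambda>e. \<forall>k<e y. P (e(x := k)))" by blast
  qed (use F in auto)
qed

lemma Sigma_False: "Sigma (\<lambda>e. False)"
  using Sigma_Eq[of Zero "Succ Zero"] by simp

text \<open>Functionality is assumed for numbers only. \<open>K\<close> makes it provable by fixing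
  a standard bound \<open>u\<close> first: once \<open>u\<close> is a numeral, both the witness and
  the value \<open>y\<close> range over finitely many numerals.\<close>

lemma representable:
  assumes "Sigma P" and functional: "\<And>e k l. P (e(y := k)) \<Longrightarrow> P (e(y := l)) \<Longrightarrow> k = l"
  shows "\<exists>K. \<forall>e m. P (e(y := m)) \<longrightarrow>
    T \<turnstile> Iff (psubst ((nums e)(y := Var y)) K) (Eq (Var y) (numeral_trm m))"
proof -
  obtain F where F: "finite F" "\<And>z. z \<notin> F \<Longrightarrow> \<exists>R. Delta R \<and> witnesses z R P"
    using assms(1) unfolding Sigma_def by blast
  obtain w where w: "w \<notin> insert y F" using F(1) ex_new_if_finite[of "insert y F"] by auto
  obtain R where R: "Delta R" "witnesses w R P" using F(2)[of w] w by auto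
    note Rw = witnessesD[OF R(2)]
  from R(1) obtain p where p: "decides p R" by (auto simp: Delta_def)
  \<comment> \<open>The bound has to dominate the value as well as the witness, since
    \<open>K\<close> demands \<open>y \<le> w\<close>.\<close>
  define q where "q = bex y w p"
  have q: "decides q (\<lambda>e. \<exists>k\<le>e w. R (e(y := k)))"
    unfolding q_def using p w by (intro decides_bex) auto
  obtain u where u: "u \<notin> fv p \<union> fv q \<union> {1, y, w}"
    using ex_new_if_finite[of "fv p \<union> fv q \<union> {1, y, w}"] by auto
  \<comment> \<open>Quantifying over \<open>w\<close> below \<open>u\<close> replaces the
    substitution of \<open>u\<close> for \<open>w\<close> in \<open>p\<close>, and
    \<open>y \<le> w\<close> is what confines a possibly nonstandard \<open>y\<close>.\<close>
  define K where "K = Exists u (And (least_fm w u q) (bex w u (And (le_fm y w) p)))"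
  have "T \<turnstile> Iff (psubst ((nums e)(y := Var y)) K) (Eq (Var y) (numeral_trm m))"
    if P: "P (e(y := m))" for e m
  proof -
    define \<sigma> where "\<sigma> = (nums e)(y := Var y, u := Var u)"
    have g: "grounding \<sigma>" by (simp add: \<sigma>_def)
    have val: "j = m" if "R (e(w := k, y := j))" for j k
    proof (rule functional[OF _ P])
      show "P (e(y := j))" using Rw(1) that w by (auto simp: fun_upd_twist)
    qed
    define W where "W k \<longleftrightarrow> (\<exists>j\<le>k. R (e(w := k, y := j)))" for k
    obtain k where "R (e(y := m, w := k))" using Rw(1) P by blast
    \<comment> \<open>By monotonicity the witness may be raised until it also bounds the value
      \<open>m\<close>.\<close>
    then have "R (e(y := m, w := max m k))" using Rw(2)[of k "max m k" "e(y := m)"] by simp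
    then have "W (max m k)" unfolding W_def using w by (intro exI[of _ m]) (simp add: fun_upd_twist)
    define n where "n = (LEAST k. W k)"
    have "W n" unfolding n_def by (rule LeastI) (fact \<open>W (max m k)\<close>)
    then obtain j where "j \<le> n" "R (e(w := n, y := j))" by (auto simp: W_def)
    moreover from this(2) have "j = m" by (rule val)
    ultimately have n: "m \<le> n" "R (e(w := n, y := m))" by simp_all
    have not_W: "\<not> W k" if "k < n" for k using that unfolding n_def by (rule not_less_Least)
    have fv_q: "y \<notin> fv q" by (simp add: q_def bex_def)
    have q_num: "psubst (\<sigma>(w := numeral_trm k)) q = psubst (nums (e(w := k))) q" for k
      by (rule psubst_cong) (use u fv_q in \<open>auto simp: \<sigma>_def nums_upd\<close>)
    have L: "T \<turnstile> Iff (psubst \<sigma> (least_fm w u q)) (Eq (Var u) (numeral_trm n))"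
    proof (rule least_fm_iff[OF g])
      show "T \<turnstile> psubst (\<sigma>(w := numeral_trm n)) q"
        unfolding q_num by (rule decides_true[OF q]) (use \<open>W n\<close> in \<open>simp add: W_def\<close>)
      show "T \<turnstile> Neg (psubst (\<sigma>(w := numeral_trm k)) q)" if "k < n" for k
        unfolding q_num by (rule decides_false[OF q]) (use not_W[OF that] in \<open>simp add: W_def\<close>)
    qed (use u in \<open>auto simp: \<sigma>_def\<close>)
    let ?\<sigma>n = "\<sigma>(u := numeral_trm n)" and ?B = "bex w u (And (le_fm y w) p)"
    have p_num: "psubst (?\<sigma>n(w := numeral_trm k)) p = psubst ((nums (e(w := k)))(y := Var y)) p" for k
      by (rule psubst_cong) (use u w in \<open>auto simp: \<sigma>_def nums_upd\<close>)
    \<comment> \<open>Both \<open>w\<close> and \<open>y\<close> are split into numerals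
      \<open>k\<close> and \<open>j\<close>; by \<open>val\<close> every \<open>j\<close> other than
      \<open>m\<close> violates \<open>R\<close>, so \<open>p\<close> is refuted there.\<close>
    have B_elim: "T \<turnstile> Imp (psubst ?\<sigma>n ?B) (Eq (Var y) (numeral_trm m))"
    proof (rule bex_elim[of ?\<sigma>n w u n])
      fix k assume "k \<le> n"
      let ?p = "psubst ((nums (e(w := k)))(y := Var y)) p" and ?z = "Suc (y + w)"
      have "T \<turnstile> Imp (Eq (Var y) (numeral_trm j)) (Imp ?p (Eq (Var y) (numeral_trm m)))" for j
      proof (cases "j = m")
        case True
        then show ?thesis by (intro derives_taut0) auto
      next
        case False
        then have "\<not> R (e(w := k, y := j))" using val by blast
        then have "T \<turnstile> Neg (subst y (numeral_trm j) ?p)"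
          using decides_false[OF p, of "e(w := k, y := j)"]
          by (simp only: simp_thms subst_psubst grounding_nums fv_numeral_trm nums_upd[of "e(w := k)" y j])
        with derives_Leibniz_Var[of "numeral_trm j" T y ?p] show ?thesis
          by (rule derives_taut2) auto
      qed
      then have "T \<turnstile> Imp (eq_some_upto (Var y) k) (Imp ?p (Eq (Var y) (numeral_trm m)))"
        by (rule derives_eq_some_uptoE)
      moreover have "T \<turnstile> Imp (Exists ?z (Eq (Add (Var ?z) (Var y)) (numeral_trm k))) (eq_some_upto (Var y) k)"
        by (rule derives_ExistsE) (use le_numeral_cases[of ?z y k] in auto)
      ultimately have "T \<turnstile> Imp (And (Exists ?z (Eq (Add (Var ?z) (Var y)) (numeral_trm k))) ?p)
        (Eq (Var y) (numeral_trm m))"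
        by (rule derives_taut2) auto
      moreover have "psubst (?\<sigma>n(w := numeral_trm k)) (le_fm y w) =
        Exists ?z (Eq (Add (Var ?z) (Var y)) (numeral_trm k))"
        using u w by (simp add: \<sigma>_def)
      ultimately show "T \<turnstile> Imp (psubst (?\<sigma>n(w := numeral_trm k)) (And (le_fm y w) p))
        (Eq (Var y) (numeral_trm m))"
        by (simp only: psubst.simps p_num)
    qed (use u w g in auto)
    have "T \<turnstile> psubst (?\<sigma>n(y := numeral_trm m)) ?B"
    proof (rule bex_intro[of "?\<sigma>n(y := numeral_trm m)" w u n n])
      have "psubst (?\<sigma>n(y := numeral_trm m, w := numeral_trm n)) p = psubst (nums (e(w := n, y := m))) p"
        by (rule psubst_cong) (use u w in \<open>auto simp: \<sigma>_def nums_upd\<close>)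
      moreover have "psubst (?\<sigma>n(y := numeral_trm m, w := numeral_trm n)) (le_fm y w) =
        Exists (Suc (y + w)) (Eq (Add (Var (Suc (y + w))) (numeral_trm m)) (numeral_trm n))"
        using w by simp
      moreover have "T \<turnstile> And (Exists (Suc (y + w)) (Eq (Add (Var (Suc (y + w))) (numeral_trm m)) (numeral_trm n)))
        (psubst (nums (e(w := n, y := m))) p)"
        by (rule derives_taut2[OF le_true[OF n(1), of "Suc (y + w)"] decides_true[OF p, OF n(2)]]) simp
      ultimately show "T \<turnstile> psubst (?\<sigma>n(y := numeral_trm m, w := numeral_trm n)) (And (le_fm y w) p)"
        by (simp only: psubst.simps)
    qed (use u w g in auto)
    moreover have "subst y (numeral_trm m) (psubst ?\<sigma>n ?B) = psubst (?\<sigma>n(y := numeral_trm m)) ?B"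
    proof -
      have "?\<sigma>n(y := Var y) = ?\<sigma>n" using u by (auto simp: \<sigma>_def)
      then show ?thesis using subst_psubst[of ?\<sigma>n "numeral_trm m" y ?B] g by (simp only: grounding_simps fv_numeral_trm)
    qed
    ultimately have "T \<turnstile> subst y (numeral_trm m) (psubst ?\<sigma>n ?B)" by simp
    with derives_Leibniz_Var[of "numeral_trm m" T y "psubst ?\<sigma>n ?B"]
    have B_intro: "T \<turnstile> Imp (Eq (Var y) (numeral_trm m)) (psubst ?\<sigma>n ?B)"
      by (rule derives_taut2) auto
    have u_num: "subst u (numeral_trm n) (psubst \<sigma> r) = psubst ?\<sigma>n r" for r
    proof -
      have "\<sigma>(u := Var u) = \<sigma>" by (auto simp: \<sigma>_def)
      then show ?thesis using subst_psubst[OF g, of "numeral_trm n" u r] by simp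
    qed
    have K: "psubst ((nums e)(y := Var y)) K = Exists u (And (psubst \<sigma> (least_fm w u q)) (psubst \<sigma> ?B))"
      by (simp only: K_def \<sigma>_def psubst_connectives psubst.simps)
    have "T \<turnstile> Imp (psubst ((nums e)(y := Var y)) K) (Eq (Var y) (numeral_trm m))"
      unfolding K
    proof (rule derives_ExistsE)
      have "T \<turnstile> Imp (Eq (Var u) (numeral_trm n)) (Iff (psubst \<sigma> ?B) (psubst ?\<sigma>n ?B))"
        using derives_Leibniz_Var[of "numeral_trm n" T u "psubst \<sigma> ?B"] u_num by simp
      with L B_elim show "T \<turnstile> Imp (And (psubst \<sigma> (least_fm w u q)) (psubst \<sigma> ?B)) (Eq (Var y) (numeral_trm m))"
        by (rule derives_taut3) auto
    qed (use u in auto)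
    moreover have "T \<turnstile> Imp (Eq (Var y) (numeral_trm m)) (psubst ((nums e)(y := Var y)) K)"
    proof -
      have "T \<turnstile> subst u (numeral_trm n) (Iff (psubst \<sigma> (least_fm w u q)) (Eq (Var u) (numeral_trm n)))"
        by (rule derives_subst[OF L]) simp
      then have "T \<turnstile> Iff (psubst ?\<sigma>n (least_fm w u q)) (Eq (numeral_trm n) (numeral_trm n))"
        using u_num by simp
      from derives_taut2[OF this Refl] have "T \<turnstile> psubst ?\<sigma>n (least_fm w u q)" by auto
      moreover have "T \<turnstile> Imp (And (psubst ?\<sigma>n (least_fm w u q)) (psubst ?\<sigma>n ?B))
        (psubst ((nums e)(y := Var y)) K)"
        unfolding K using derives_ExistsI[of "numeral_trm n" u "And (psubst \<sigma> (least_fm w u q)) (psubst \<sigma> ?B)" T]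
        by (simp only: subst.simps u_num free_for_closed fv_numeral_trm)
      ultimately show ?thesis using B_intro by (rule derives_taut3[of T _ _ "Imp _ _"]) auto
    qed
    ultimately show ?thesis by (rule derives_taut2) auto
  qed
  then show ?thesis by blast
qed

end

section \<open>The beta function\<close>

definition beta :: "nat \<Rightarrow> nat \<Rightarrow> nat \<Rightarrow> nat" where
  "beta c d i = c mod (1 + (i + 1) * d)"

text \<open>The remainder is described by polynomial equations with two unknowns. The slack
  \<open>k\<close> expresses \<open>a \<le> (i + 1) * d\<close>, that is, \<open>a\<close> below the
  modulus, without an order symbol.\<close>

lemma beta_eq_iff:
  "beta c d i = a \<longleftrightarrow> (\<exists>q k. c = q * (1 + (i + 1) * d) + a \<and> a + k = (i + 1) * d)"
proof
  assume "beta c d i = a"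
  then have a: "c mod (1 + (i + 1) * d) = a" by (simp only: beta_def)
  have "c = c div (1 + (i + 1) * d) * (1 + (i + 1) * d) + a"
    using div_mult_mod_eq[of c "1 + (i + 1) * d"] unfolding a by (rule sym)
  moreover have "a \<le> (i + 1) * d"
    using mod_less_divisor[of "1 + (i + 1) * d" c] unfolding a by simp
  ultimately  show "\<exists>q k. c = q * (1 + (i + 1) * d) + a \<and> a + k = (i + 1) * d"
    by (metis le_add_diff_inverse)
next
  assume "\<exists>q k. c = q * (1 + (i + 1) * d) + a \<and> a + k = (i + 1) * d"
  then obtain q k where "c = a + q * (1 + (i + 1) * d)" "a + k = (i + 1) * d" by auto
  then show "beta c d i = a" unfolding beta_def by (simp only: mod_mult_self1) simp
qed

text \<open>Goedel's argument: for a large factorial \<open>d\<close> the moduli are pairwise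
  coprime, and the Chinese remainder theorem supplies \<open>c\<close>. A prime dividing two moduli
  divides \<open>(j - i) * d\<close>, hence \<open>d\<close> in either case, hence 1.\<close>

lemma ex_beta: "\<exists>c d. \<forall>i\<le>n. beta c d i = s i" for s :: "nat \<Rightarrow> nat"
proof -
  \<comment> \<open>\<open>N\<close> serves two ends: as \<open>n \<le> N\<close>, every prime
    factor of a difference \<open>j - i\<close> divides \<open>fact N\<close>, and the sum makes
    \<open>d\<close> at least as large as every \<open>s i\<close>.\<close>
  define N where "N = Suc (n + (\<Sum>i\<le>n. s i))"
  define d :: nat where "d = fact N"
  have d: "s i < 1 + (i + 1) * d" if "i \<le> n" for i
  proof -
    have "s i \<le> (\<Sum>i\<le>n. s i)" using that by (intro member_le_sum) auto
    also have "\<dots> \<le> d" using fact_ge_self[of N] by (simp add: N_def d_def)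
    also have "\<dots> \<le> (i + 1) * d" by simp
    finally show ?thesis by simp
  qed
  have "coprime (1 + (i + 1) * d) (1 + (j + 1) * d)" if "i < j" "j \<le> n" for i j
  proof (rule ccontr)
    assume "\<not> ?thesis"
    then have "gcd (1 + (i + 1) * d) (1 + (j + 1) * d) \<noteq> 1" by (simp only: coprime_iff_gcd_eq_1 simp_thms)
    then obtain p where "prime p" "p dvd gcd (1 + (i + 1) * d) (1 + (j + 1) * d)"
      using prime_factor_nat by blast
    then have p: "prime p" "p dvd 1 + (i + 1) * d" "p dvd 1 + (j + 1) * d"
      by (simp_all only: gcd_greatest_iff)
    from p(3,2) have "p dvd (1 + (j + 1) * d) - (1 + (i + 1) * d)" by (intro dvd_diff_nat)
    also have "(1 + (j + 1) * d) - (1 + (i + 1) * d) = (j - i) * d"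
      using that by (simp add: algebra_simps)
    finally have "p dvd j - i \<or> p dvd d" using p(1) by (simp add: prime_dvd_mult_iff)
    moreover have "p dvd d" if "p dvd j - i"
    proof -
      have "p \<le> N" using dvd_imp_le[OF that] \<open>i < j\<close> \<open>j \<le> n\<close> by (simp add: N_def)
      then show ?thesis unfolding d_def by (intro dvd_fact prime_ge_1_nat p(1))
    qed
    ultimately have "p dvd (i + 1) * d" by auto
    with p(2) have "p dvd 1" using dvd_add_left_iff by blast
    with p(1) show False by auto
  qed
  then have "\<forall>i\<in>{..n}. \<forall>j\<in>{..n}. i \<noteq> j \<longrightarrow> coprime (1 + (i + 1) * d) (1 + (j + 1) * d)"
    by (metis atMost_iff coprime_commute linorder_neqE_nat)
  from chinese_remainder_nat[OF _ this, of s] obtain c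
    where "\<forall>i\<in>{..n}. [c = s i] (mod 1 + (i + 1) * d)" by auto
  then have "\<forall>i\<le>n. beta c d i = s i"
    using d by (simp add: beta_def cong_def)
  then show ?thesis by blast
qed

section \<open>Graphs of partial recursive functions\<close>

lemma rec_eval_Zero_iff: "rec_eval RZero xs y \<longleftrightarrow> y = 0"
  by (subst rec_eval.simps) auto

lemma rec_eval_Succ_iff: "rec_eval RSucc xs y \<longleftrightarrow> (\<exists>x. xs = [x] \<and> y = Suc x)"
  by (subst rec_eval.simps) auto

lemma rec_eval_Proj_iff: "rec_eval (RProj i) xs y \<longleftrightarrow> i < length xs \<and> y = xs ! i"
  by (subst rec_eval.simps) auto

lemma rec_eval_Comp_iff:
  "rec_eval (RComp f gs) xs y \<longleftrightarrow> (\<exists>ys. list_all2 (\<lambda>g z. rec_eval g xs z) gs ys \<and> rec_eval f ys y)"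
  by (subst rec_eval.simps) auto

lemma rec_eval_Mu_iff:
  "rec_eval (RMu f) xs y \<longleftrightarrow>
    rec_eval f (y # xs) 0 \<and> (\<forall>m<y. \<exists>k. rec_eval f (m # xs) (Suc k))"
  by (subst rec_eval.simps) auto

lemma rec_eval_Prim_Nil: "\<not> rec_eval (RPrim f g) [] y"
  by (subst rec_eval.simps) auto

lemma rec_eval_Prim_iff_seq:
  "rec_eval (RPrim f g) (n # xs) y \<longleftrightarrow>
    (\<exists>s. rec_eval f xs (s 0) \<and> (\<forall>i<n. rec_eval g (i # s i # xs) (s (Suc i))) \<and> s n = y)"
proof
  show "\<exists>s. rec_eval f xs (s 0) \<and> (\<forall>i<n. rec_eval g (i # s i # xs) (s (Suc i))) \<and> s n = y"
    if "rec_eval (RPrim f g) (n # xs) y"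
    using that
  proof (induction n arbitrary: y)
    case 0
    then have "rec_eval f xs y" by cases
    then show ?case by (intro exI[of _ "\<lambda>_. y"]) auto
  next
    case (Suc n)
    from Suc.prems obtain z where z: "rec_eval (RPrim f g) (n # xs) z" "rec_eval g (n # z # xs) y"
      by cases
    from Suc.IH[OF z(1)] obtain s where
      "rec_eval f xs (s 0)" "\<forall>i<n. rec_eval g (i # s i # xs) (s (Suc i))" "s n = z" by blast
    with z(2) show ?case by (intro exI[of _ "s(Suc n := y)"]) (auto simp: less_Suc_eq)
  qed
next
  assume "\<exists>s. rec_eval f xs (s 0) \<and> (\<forall>i<n. rec_eval g (i # s i # xs) (s (Suc i))) \<and> s n = y"
  then obtain s where s: "rec_eval f xs (s 0)" "\<And>i. i < n \<Longrightarrow> rec_eval g (i # s i # xs) (s (Suc i))"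
    "s n = y" by blast
  have "i \<le> n \<Longrightarrow> rec_eval (RPrim f g) (i # xs) (s i)" for i
    by (induction i) (auto intro: rec_eval.intros(5) s(1) rec_eval.intros(6)[OF _ s(2)])
  with s(3) show "rec_eval (RPrim f g) (n # xs) y" by blast
qed

text \<open>The sequence of intermediate values becomes the pair \<open>c\<close>, \<open>d\<close>.
  Beta values are named by \<open>a\<close> and \<open>b\<close> because
  \<open>Sigma_rec_eval\<close> takes variables as arguments and result.\<close>

lemma rec_eval_Prim_iff_beta:
  "rec_eval (RPrim f g) (n # xs) y \<longleftrightarrow>
    (\<exists>c d. (\<exists>a. beta c d 0 = a \<and> rec_eval f xs a) \<and>
      (\<forall>i<n. \<exists>a b. beta c d i = a \<and> beta c d (Suc i) = b \<and> rec_eval g (i # a # xs) b) \<and>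
      beta c d n = y)"
proof
  assume "rec_eval (RPrim f g) (n # xs) y"
  then obtain s where s: "rec_eval f xs (s 0)" "\<And>i. i < n \<Longrightarrow> rec_eval g (i # s i # xs) (s (Suc i))"
    "s n = y" unfolding rec_eval_Prim_iff_seq by blast
  obtain c d where "\<forall>i\<le>n. beta c d i = s i" using ex_beta by blast
  with s show "\<exists>c d. (\<exists>a. beta c d 0 = a \<and> rec_eval f xs a) \<and>
      (\<forall>i<n. \<exists>a b. beta c d i = a \<and> beta c d (Suc i) = b \<and> rec_eval g (i # a # xs) b) \<and>
      beta c d n = y"
    by (intro exI[of _ c] exI[of _ d]) auto
next
  assume "\<exists>c d. (\<exists>a. beta c d 0 = a \<and> rec_eval f xs a) \<and>
      (\<forall>i<n. \<exists>a b. beta c d i = a \<and> beta c d (Suc i) = b \<and> rec_eval g (i # a # xs) b) \<and>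
      beta c d n = y"
  then obtain c d where "rec_eval f xs (beta c d 0)" "beta c d n = y"
    "\<forall>i<n. rec_eval g (i # beta c d i # xs) (beta c d (Suc i))" by blast
  then show "rec_eval (RPrim f g) (n # xs) y"
    unfolding rec_eval_Prim_iff_seq by (intro exI[of _ "beta c d"]) simp
qed

context R_theory
begin

text \<open>The index is a term so that 0, \<open>i\<close> and \<open>Suc i\<close> are covered at
  once; \<open>F\<close> collects the variables that quotient and slack have to avoid.\<close>

lemma Sigma_beta:
  assumes "finite F" "fv_trm t \<subseteq> F" "c \<in> F" "d \<in> F" "a \<in> F"
  shows "Sigma (\<lambda>e. beta (e c) (e d) (eval_trm e t) = e a)"
proof -
  obtain q where q: "q \<notin> F" using assms(1) ex_new_if_finite by auto
  obtain k where k: "k \<notin> insert q F" using assms(1) ex_new_if_finite[of "insert q F"] by auto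
  have fresh: "q \<notin> fv_trm t" "k \<notin> fv_trm t" "q \<noteq> k" "c \<noteq> q" "c \<noteq> k" "d \<noteq> q" "d \<noteq> k" "a \<noteq> q" "a \<noteq> k"
    using assms q k by auto
  let ?m = "Mult (Add t (Succ Zero)) (Var d)"
  let ?s = "Add (Mult (Var q) (Add (Succ Zero) ?m)) (Var a)"
  have "Sigma (\<lambda>e. \<exists>i j. eval_trm (e(q := i, k := j)) (Var c) = eval_trm (e(q := i, k := j)) ?s \<and>
      eval_trm (e(q := i, k := j)) (Add (Var a) (Var k)) = eval_trm (e(q := i, k := j)) ?m)"
    by (intro Sigma_ex[of "\<lambda>e. \<exists>j. eval_trm (e(k := j)) (Var c) = eval_trm (e(k := j)) ?s \<and>
          eval_trm (e(k := j)) (Add (Var a) (Var k)) = eval_trm (e(k := j)) ?m" q]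
        Sigma_ex[of "\<lambda>e. eval_trm e (Var c) = eval_trm e ?s \<and>
          eval_trm e (Add (Var a) (Var k)) = eval_trm e ?m" k] Sigma_conj Sigma_Eq)
  then show ?thesis
    using fresh by (simp add: beta_eq_iff)
qed

text \<open>Arguments and result are named by arbitrary variables, repetitions allowed, so that the
  induction hypotheses apply to freshly chosen ones.\<close>

lemma Sigma_rec_eval: "Sigma (\<lambda>e. rec_eval r (map e xs) (e y))"
proof (induction r arbitrary: xs y)
  case RZero
  show ?case using Sigma_Eq[of "Var y" Zero] by (simp add: rec_eval_Zero_iff)
next
  case RSucc
  show ?case
  proof (cases "\<exists>x. xs = [x]")
    case True
    then obtain x where "xs = [x]" by blast
    then show ?thesis using Sigma_Eq[of "Var y" "Succ (Var x)"] by (simp add: rec_eval_Succ_iff)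
  next
    case False
    then show ?thesis using Sigma_False by (auto simp: rec_eval_Succ_iff map_eq_Cons_conv)
  qed
next
  case (RProj i)
  show ?case
    using Sigma_Eq[of "Var y" "Var (xs ! i)"] Sigma_False by (cases "i < length xs") (auto simp: rec_eval_Proj_iff)
next
  case (RComp f gs)
  \<comment> \<open>The inner values are moved into variables one at a time: \<open>us\<close> names
    those already computed, \<open>hs\<close> lists the functions still to be evaluated.\<close>
  have "Sigma (\<lambda>e. \<exists>zs. list_all2 (\<lambda>g z. rec_eval g (map e xs) z) hs zs \<and>
      rec_eval f (map e us @ zs) (e y))" if "set hs \<subseteq> set gs" for hs us
    using that
  proof (induction hs arbitrary: us)
    case Nil
    show ?case using RComp.IH(1) by simp
  next
    case (Cons h hs)
    obtain u where u: "u \<notin> set xs \<union> set us \<union> {y}"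
      using ex_new_if_finite[of "set xs \<union> set us \<union> {y}"] by auto
    have "Sigma (\<lambda>e. \<exists>k. rec_eval h (map (e(u := k)) xs) ((e(u := k)) u) \<and>
      (\<exists>zs. list_all2 (\<lambda>g z. rec_eval g (map (e(u := k)) xs) z) hs zs \<and>
      rec_eval f (map (e(u := k)) (us @ [u]) @ zs) ((e(u := k)) y)))"
      by (rule Sigma_ex[of "\<lambda>e. rec_eval h (map e xs) (e u) \<and>
          (\<exists>zs. list_all2 (\<lambda>g z. rec_eval g (map e xs) z) hs zs \<and>
            rec_eval f (map e (us @ [u]) @ zs) (e y))"])
        (rule Sigma_conj[OF RComp.IH(2) Cons.IH], use Cons.prems in auto)
    moreover have "(\<exists>zs. list_all2 (\<lambda>g z. rec_eval g (map e xs) z) (h # hs) zs \<and>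
      rec_eval f (map e us @ zs) (e y)) \<longleftrightarrow>
      (\<exists>k. rec_eval h (map (e(u := k)) xs) ((e(u := k)) u) \<and>
      (\<exists>zs. list_all2 (\<lambda>g z. rec_eval g (map (e(u := k)) xs) z) hs zs \<and>
      rec_eval f (map (e(u := k)) (us @ [u]) @ zs) ((e(u := k)) y)))" for e
      using u by (auto simp: list_all2_Cons1)
    ultimately show ?case by simp
  qed
  from this[of gs "[]"] show ?case by (simp add: rec_eval_Comp_iff)
next
  case (RPrim f g)
  show ?case
  proof (cases xs)
    case Nil
    then show ?thesis using Sigma_False by (simp add: rec_eval_Prim_Nil)
  next
    case (Cons n vs)
    \<comment> \<open>Being above all variables in use, \<open>c\<close> to \<open>c + 4\<close> are
      fresh; they hold the two beta codes, the index and two consecutive values.\<close>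
    define c where "c = Suc (Max (insert y (set xs)))"
    have fresh: "v < c" if "v \<in> insert y (set xs)" for v
      using Max_ge[OF _ that] by (simp add: c_def less_Suc_eq_le)
    then have less: "y < c" "n < c" and notin: "c + j \<notin> set vs" "c \<notin> set vs" "Suc c \<notin> set vs"
      "Suc (Suc c) \<notin> set vs" for j
      using Cons by force+
    let ?d = "c + 1" and ?i = "c + 2" and ?a = "c + 3" and ?b = "c + 4"
    let ?F = "{y, n, c, ?d, ?i, ?a, ?b}"
    define P1 where "P1 e \<longleftrightarrow> beta (e c) (e ?d) (eval_trm e Zero) = e ?a \<and> rec_eval f (map e vs) (e ?a)" for e
    define P2 where "P2 e \<longleftrightarrow> beta (e c) (e ?d) (eval_trm e (Var ?i)) = e ?a \<and>
      beta (e c) (e ?d) (eval_trm e (Succ (Var ?i))) = e ?b \<and> rec_eval g (map e (?i # ?a # vs)) (e ?b)" for e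
    define P3 where "P3 e \<longleftrightarrow> (\<exists>a. P1 (e(?a := a))) \<and>
      (\<forall>i<e n. \<exists>a b. P2 (e(?i := i, ?a := a, ?b := b))) \<and>
      beta (e c) (e ?d) (eval_trm e (Var n)) = e y" for e
    have "Sigma P1" unfolding P1_def
      by (intro Sigma_conj Sigma_beta[of ?F] RPrim.IH) auto
    then have S1: "Sigma (\<lambda>e. \<exists>a. P1 (e(?a := a)))" by (rule Sigma_ex)
    have "Sigma P2" unfolding P2_def
      by (intro Sigma_conj Sigma_beta[of ?F] RPrim.IH) auto
    from Sigma_ball[OF Sigma_ex[OF Sigma_ex[OF this, of ?b], of ?a], of ?i n] less
    have S2: "Sigma (\<lambda>e. \<forall>i<e n. \<exists>a b. P2 (e(?i := i, ?a := a, ?b := b)))" by simp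
    have "Sigma P3" unfolding P3_def
      by (intro Sigma_conj S1 S2 Sigma_beta[of ?F]) auto
    then have "Sigma (\<lambda>e. \<exists>i j. P3 (e(c := i, ?d := j)))" by (intro Sigma_ex)
    moreover have "rec_eval (RPrim f g) (map e xs) (e y) \<longleftrightarrow> (\<exists>i j. P3 (e(c := i, ?d := j)))" for e
      using less notin unfolding Cons
      by (simp add: rec_eval_Prim_iff_beta P1_def P2_def P3_def)
    ultimately show ?thesis by simp
  qed
next
  case (RMu f)
  define c where "c = Suc (Max (insert y (set xs)))"
  have fresh: "v < c" if "v \<in> insert y (set xs)" for v
    using Max_ge[OF _ that] by (simp add: c_def less_Suc_eq_le)
  then have less: "y < c" and notin: "c + j \<notin> set xs" "c \<notin> set xs" "Suc c \<notin> set xs"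
    "Suc (Suc c) \<notin> set xs" for j by force+
  \<comment> \<open>Variable \<open>c\<close> holds the output 0 in \<open>P1\<close> and the
    smaller argument in \<open>P2\<close>; there \<open>c + 2\<close> holds the output and
    \<open>c + 1\<close> its predecessor, so that being nonzero is an equation.\<close>
  define P1 where "P1 e \<longleftrightarrow> eval_trm e (Var c) = eval_trm e Zero \<and> rec_eval f (map e (y # xs)) (e c)" for e
  define P2 where "P2 e \<longleftrightarrow> eval_trm e (Var (c + 2)) = eval_trm e (Succ (Var (c + 1))) \<and>
    rec_eval f (map e (c # xs)) (e (c + 2))" for e
  have "Sigma P1" unfolding P1_def by (intro Sigma_conj Sigma_Eq RMu.IH)
  then have S1: "Sigma (\<lambda>e. \<exists>a. P1 (e(c := a)))" by (rule Sigma_ex)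
  have "Sigma P2" unfolding P2_def by (intro Sigma_conj Sigma_Eq RMu.IH)
  from Sigma_ball[OF Sigma_ex[OF Sigma_ex[OF this, of "c + 2"], of "c + 1"], of c y] less
  have "Sigma (\<lambda>e. \<forall>m<e y. \<exists>k b. P2 (e(c := m, c + 1 := k, c + 2 := b)))" by simp
  from Sigma_conj[OF S1 this]
  have "Sigma (\<lambda>e. (\<exists>a. P1 (e(c := a))) \<and> (\<forall>m<e y. \<exists>k b. P2 (e(c := m, c + 1 := k, c + 2 := b))))" .
  then show ?case
    using less notin by (simp add: rec_eval_Mu_iff P1_def P2_def)
qed

end

section \<open>The diagonal lemma\<close>

primrec const_recf :: "nat \<Rightarrow> recf" where
  "const_recf 0 = RZero"
| "const_recf (Suc k) = RComp RSucc [const_recf k]"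

lemma rec_eval_const_recf: "rec_eval (const_recf k) xs k"
proof (induction k)
  case (Suc k)
  then have "list_all2 (\<lambda>g z. rec_eval g xs z) [const_recf k] [k]" by simp
  then show ?case unfolding const_recf.simps by (rule rec_eval.intros(4)) (rule rec_eval.intros(2))
qed (simp add: rec_eval.intros)

lemma rec_eval_Comp2:
  assumes "rec_eval g xs a" "rec_eval h xs b" "rec_eval f [a, b] c"
  shows "rec_eval (RComp f [g, h]) xs c"
  by (rule rec_eval.intros(4)[of xs "[g, h]" "[a, b]"]) (use assms in auto)

lemma rec_eval_Proj: "i < length xs \<Longrightarrow> xs ! i = y \<Longrightarrow> rec_eval (RProj i) xs y"
  using rec_eval.intros(3) by blast

lemma computable_simulation_append:
  assumes "computable_simulation \<alpha>"
  shows "\<exists>r. \<forall>a b. a \<noteq> [] \<longrightarrow> b \<noteq> [] \<longrightarrow> rec_eval r [\<alpha> a, \<alpha> b] (\<alpha> (a @ b))"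
proof -
  from assms obtain r where r: "\<And>xs y. length xs = 2 \<Longrightarrow> rec_eval r xs y \<longleftrightarrow>
    (if xs ! 0 \<in> \<alpha> ` strings \<and> xs ! 1 \<in> \<alpha> ` strings
     then Some (concat_op \<alpha> (xs ! 0) (xs ! 1)) else None) = Some y"
    unfolding computable_simulation_def partial_recursive_def by blast
  have inj: "inj_on \<alpha> strings" using assms by (simp add: computable_simulation_def numbering_def)
  have "rec_eval r [\<alpha> a, \<alpha> b] (\<alpha> (a @ b))" if "a \<noteq> []" "b \<noteq> []" for a b
  proof -
    have "a \<in> strings" "b \<in> strings" using that by (auto simp: strings_def)
    then show ?thesis
      using r[of "[\<alpha> a, \<alpha> b]" "\<alpha> (a @ b)"] inj by (simp add: concat_op_def inv_into_f_f)
  qed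
  then show ?thesis by blast
qed

lemma trm_string_nonempty [simp]: "trm_string t \<noteq> []"
  by (cases t) (auto simp: var_string_def)

lemma fm_string_nonempty [simp]: "fm_string p \<noteq> []"
  by (cases p) auto

text \<open>The string \<open>w\<close> is copied as a block and never inspected, so its code need
  not be decoded. All parts are nonempty because \<open>\<alpha>\<close> is meaningful on nonempty
  strings only.\<close>

lemma diagonal_recursive:
  assumes "computable_simulation \<alpha>" "pre \<noteq> []" "mid \<noteq> []" "post \<noteq> []"
  shows "\<exists>D. \<forall>w. w \<noteq> [] \<longrightarrow>
    rec_eval D [\<alpha> w] (\<alpha> (pre @ trm_string (numeral_trm (\<alpha> w)) @ mid @ w @ post))"
proof -
  obtain r where r: "\<And>a b. a \<noteq> [] \<Longrightarrow> b \<noteq> [] \<Longrightarrow> rec_eval r [\<alpha> a, \<alpha> b] (\<alpha> (a @ b))"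
    using computable_simulation_append[OF assms(1)] by blast
  define C where "C a = const_recf (\<alpha> a)" for a
  \<comment> \<open>A numeral is \<open>LSuc\<close> repeated in front of \<open>LZero\<close>, so
    its code arises by primitive recursion; \<open>RProj 1\<close> is the previous value, position 0
    being the counter.\<close>
  define N where "N = RPrim (C [LZero]) (RComp r [C [LSuc], RProj 1])"
  define D where "D = RComp r [C pre, RComp r [N, RComp r [C mid, RComp r [RProj 0, C post]]]]"
  have C: "rec_eval (C a) xs (\<alpha> a)" for a xs by (simp add: C_def rec_eval_const_recf)
  have append: "rec_eval (RComp r [g, h]) xs (\<alpha> (a @ b))"
    if "rec_eval g xs (\<alpha> a)" "rec_eval h xs (\<alpha> b)" "a \<noteq> []" "b \<noteq> []" for g h xs a b
    using rec_eval_Comp2[OF that(1,2) r[OF that(3,4)]] .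
  have N: "rec_eval N [n] (\<alpha> (trm_string (numeral_trm n)))" for n
  proof (induction n)
    case 0
    show ?case unfolding N_def using C[of "[LZero]" "[]"] by (auto intro: rec_eval.intros(5))
  next
    case (Suc n)
    have "rec_eval (RComp r [C [LSuc], RProj 1]) [n, \<alpha> (trm_string (numeral_trm n))]
      (\<alpha> ([LSuc] @ trm_string (numeral_trm n)))"
      by (intro append C rec_eval_Proj) auto
    from rec_eval.intros(6)[OF Suc[unfolded N_def] this] show ?case by (simp add: N_def)
  qed
  have "rec_eval D [\<alpha> w] (\<alpha> (pre @ trm_string (numeral_trm (\<alpha> w)) @ mid @ w @ post))"
    if "w \<noteq> []" for w
    unfolding D_def by (intro append C N rec_eval_Proj) (use assms that in auto)
  then show ?thesis by blast
qed

lemma fv_subst_closed: "fv_trm t = {} \<Longrightarrow> fv (subst x t p) = fv p - {x}"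
  by (auto simp: subst_eq_psubst fv_psubst)

section \<open>The fixed point\<close>

context R_theory
begin

text \<open>This lets a sentence assembled by concatenation act as a substitution instance; the
  negation produced here is the one that the fixed point carries.\<close>

lemma derives_substituted_Forall:
  assumes "fv_trm t = {}"
  shows "T \<turnstile> Iff (Forall x (Neg (And (Eq (Var x) t) p))) (Neg (subst x t p))"
proof -
  let ?q = "Neg (And (Eq (Var x) t) p)"
  have "T \<turnstile> Imp (Forall x ?q) (Neg (subst x t p))"
    by (rule derives_taut2[OF Inst[of t x ?q] Refl[of T t]]) (use assms in auto)
  moreover have "T \<turnstile> Imp (Neg (subst x t p)) (Forall x ?q)"
  proof (rule MP[OF Distrib Gen])
    show "T \<turnstile> Imp (Neg (subst x t p)) ?q"
      by (rule derives_taut1[OF derives_Leibniz_Var[OF assms, of T x p]]) auto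
  qed (simp add: fv_subst_closed assms)
  ultimately show ?thesis by (rule derives_taut2) auto
qed

text \<open>With \<open>q\<close> representing a function at one argument, the left side applies
  \<open>p\<close> to its value.\<close>

lemma derives_Exists_eq:
  assumes "fv_trm t = {}" "T \<turnstile> Iff q (Eq (Var x) t)"
  shows "T \<turnstile> Iff (Exists x (And q p)) (subst x t p)"
proof -
  have "T \<turnstile> Imp (Exists x (And q p)) (subst x t p)"
    by (rule derives_ExistsE[OF derives_taut2[OF assms(2) derives_Leibniz_Var[OF assms(1), of T x p]]])
      (auto simp: fv_subst_closed assms)
  moreover have "T \<turnstile> Iff (subst x t q) (Eq t t)"
    using derives_subst[OF assms(2), of t x] assms(1) by simp
  then have "T \<turnstile> Imp (subst x t p) (Exists x (And q p))"
    by (rule derives_taut3[OF _ Refl[of T t] derives_ExistsI[of t x "And q p"]]) (use assms in auto)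
  ultimately show ?thesis by (rule derives_taut2) auto
qed

text \<open>\<open>\<psi>\<close> says of \<open>v\<close> that \<open>\<tau>\<close> holds at the
  value of \<open>D\<close> at \<open>v\<close>. For \<open>v = n\<close>, the code of
  \<open>\<psi>\<close>, this value is the code \<open>m\<close> of \<open>\<phi>\<close>, and
  \<open>T\<close> proves that \<open>K\<close> pins it down. So \<open>\<psi>\<close> at
  \<open>n\<close> is equivalent to \<open>\<tau>\<close> at the code of \<open>\<phi>\<close>, and
  \<open>\<phi>\<close> to its negation.\<close>

lemma diagonal_lemma:
  assumes "computable_simulation \<alpha>" "fv \<tau> = {x}"
  shows "\<exists>\<phi>. sentence \<phi> \<and> T \<turnstile> Iff \<phi> (Neg (subst x (quote \<alpha> \<phi>) \<tau>))"
proof -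
  define v where "v = Suc x"
  \<comment> \<open>One parenthesis opens the conjunction, the other the equation;
    \<open>[LClose, LAnd]\<close> closes the equation and the final \<open>[LClose]\<close> the
    conjunction.\<close>
  define pre where "pre = LAll # var_string v @ [LNot, LOpen, LOpen] @ var_string v @ [LEq]"
  obtain D where D: "\<And>w. w \<noteq> [] \<Longrightarrow>
    rec_eval D [\<alpha> w] (\<alpha> (pre @ trm_string (numeral_trm (\<alpha> w)) @ [LClose, LAnd] @ w @ [LClose]))"
    using diagonal_recursive[OF assms(1), of pre "[LClose, LAnd]" "[LClose]"] by (auto simp: pre_def)
  have "\<exists>K. \<forall>e m. rec_eval D (map (e(x := m)) [v]) ((e(x := m)) x) \<longrightarrow>
    T \<turnstile> Iff (psubst ((nums e)(x := Var x)) K) (Eq (Var x) (numeral_trm m))"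
    by (rule representable[OF Sigma_rec_eval]) (auto simp: v_def intro: rec_eval_deterministic)
  then obtain K where K: "\<And>e m. rec_eval D [e v] m \<Longrightarrow>
    T \<turnstile> Iff (psubst ((nums e)(x := Var x)) K) (Eq (Var x) (numeral_trm m))"
    by (auto simp: v_def)
  \<comment> \<open>\<open>K\<close> may have further free variables. They are set to
    \<open>Zero\<close> to make \<open>\<phi>\<close> a sentence, in agreement with the assignment
    \<open>?e\<close>, which is 0 away from \<open>v\<close>.\<close>
  define \<rho> where "\<rho> z = (if z \<in> {v, x} then Var z else Zero)" for z
  have \<rho>: "grounding \<rho>" by (simp add: grounding_def \<rho>_def)
  define \<psi> where "\<psi> = Exists x (And (psubst \<rho> K) \<tau>)"
  define n where "n = \<alpha> (fm_string \<psi>)"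
  define \<phi> where "\<phi> = Forall v (Neg (And (Eq (Var v) (numeral_trm n)) \<psi>))"
  define m where "m = \<alpha> (fm_string \<phi>)"
  have "fv \<psi> \<subseteq> {v}"
    using assms(2) by (auto simp: \<psi>_def fv_psubst[OF \<rho>] \<rho>_def split: if_splits)
  then have "sentence \<phi>" by (auto simp: sentence_def \<phi>_def)
  have "fm_string \<phi> = pre @ trm_string (numeral_trm n) @ [LClose, LAnd] @ fm_string \<psi> @ [LClose]"
    by (simp add: \<phi>_def pre_def)
  then have "rec_eval D [n] m" using D[of "fm_string \<psi>"] by (simp add: n_def m_def)
  let ?e = "(\<lambda>_. 0)(v := n)"
  have "psubst (Var(v := numeral_trm n)) (psubst \<rho> K) = psubst ((nums ?e)(x := Var x)) K"
  proof -
    have "(\<lambda>z. psubst_trm (Var(v := numeral_trm n)) (\<rho> z)) = (nums ?e)(x := Var x)"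
      by (rule ext) (auto simp: \<rho>_def nums_def v_def)
    then show ?thesis by (simp only: psubst_psubst[OF \<rho>])
  qed
  then have "subst v (numeral_trm n) \<psi> = Exists x (And (psubst ((nums ?e)(x := Var x)) K) \<tau>)"
    using assms(2) by (simp add: \<psi>_def v_def flip: subst_eq_psubst)
  moreover have "T \<turnstile> Iff (psubst ((nums ?e)(x := Var x)) K) (Eq (Var x) (numeral_trm m))"
    by (rule K) (use \<open>rec_eval D [n] m\<close> in simp)
  ultimately have "T \<turnstile> Iff (subst v (numeral_trm n) \<psi>) (subst x (quote \<alpha> \<phi>) \<tau>)"
    using derives_Exists_eq[of "numeral_trm m"] by (simp add: quote_def m_def)
  moreover have "T \<turnstile> Iff \<phi> (Neg (subst v (numeral_trm n) \<psi>))"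
    unfolding \<phi>_def by (rule derives_substituted_Forall) simp
  ultimately have "T \<turnstile> Iff \<phi> (Neg (subst x (quote \<alpha> \<phi>) \<tau>))"
    by (rule derives_taut2) auto
  with \<open>sentence \<phi>\<close> show ?thesis by blast
qed

end

theorem corollary4p10:
  fixes T :: "fm set" and \<alpha> :: "letter list \<Rightarrow> nat"
  assumes "consistent T"
    and "re_theory T"
    and "extends T theory_R"
    and "computable_simulation \<alpha>"
  shows "\<not> (\<exists>\<tau> x. fv \<tau> = {x} \<and>
           (\<forall>\<phi>. sentence \<phi> \<longrightarrow> T \<turnstile> Iff \<phi> (subst x (quote \<alpha> \<phi>) \<tau>)))"
proof
  assume "\<exists>\<tau> x. fv \<tau> = {x} \<and> (\<forall>\<phi>. sentence \<phi> \<longrightarrow> T \<turnstile> Iff \<phi> (subst x (quote \<alpha> \<phi>) \<tau>))"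
  then obtain \<tau> x where \<tau>: "fv \<tau> = {x}"
    and truth: "\<And>\<phi>. sentence \<phi> \<Longrightarrow> T \<turnstile> Iff \<phi> (subst x (quote \<alpha> \<phi>) \<tau>)" by blast
  interpret R_theory T by standard (fact assms(3))
  obtain \<phi> where \<phi>: "sentence \<phi>" "T \<turnstile> Iff \<phi> (Neg (subst x (quote \<alpha> \<phi>) \<tau>))"
    using diagonal_lemma[OF assms(4) \<tau>] by blast
  \<comment> \<open>No valuation satisfies both equivalences, so every formula follows from
    them.\<close>
  from derives_taut2[OF \<phi>(2) truth[OF \<phi>(1)]] have "T \<turnstile> \<phi>" "T \<turnstile> Neg \<phi>" by auto
  with assms(1) show False by (auto simp: consistent_def)
qed

end
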